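(* Let $E$ and $F$ be two Banach lattices such that the lattice operations of $E^*$ are sequentially weak* continuous or $F$ has property (d). Then for an order bounded operator $T:E\to F$, the following assertions are equivalent: (1) $T$ is weak almost limited. (2) For every weakly null sequence $(x_n)\subset E^+$ and every disjoint weak* null sequence $(f_n)\subset F^*$ we have $f_n(Tx_n)\to 0$. (3) For every disjoint weakly null sequence $(x_n)\subset E$ and every disjoint weak* null sequence $(f_n)\subset F^*$ we have $f_n(Tx_n)\to 0$. (4) For every disjoint weakly null sequence $(x_n)\subset E^+$ and every disjoint weak* null sequence $(f_n)\subset F^*$ we have $f_n(Tx_n)\to 0$. (5) $T$ carries the solid hull of each relatively weakly compact subset of $E$ to an almost limited subset of $F$. Moreover, if $F$ has property (d), then (1)--(5) are also equivalent to each of the following: (6) $f_n(Tx_n)\to 0$ for every weakly null sequence $(x_n)\subset E^+$ and every disjoint weak* null sequence $(f_n)\subset (F^* )^+$. (7) $f_n(Tx_n)\to 0$ for every disjoint weakly null sequence $(x_n)\subset E^+$ and every disjoint weak* null sequence $(f_n)\subset (F^* )^+$.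
   Context: All Banach lattices are real; "operator" means bounded linear mapping. A sequence $(f_n)$ in a Banach lattice is disjoint if $|f_n|\wedge|f_m|=0$ for $n\neq m$. $E^+$ denotes the positive cone of $E$. A Banach lattice $F$ has property (d) if $|f_n|\xrightarrow{w^*}0$ in $F^*$ for every disjoint sequence $(f_n)$ in $F^*$ with $f_n\xrightarrow{w^*}0$. The lattice operations of $E^*$ are sequentially weak* continuous if $f_n\xrightarrow{w^*}0$ in $E^*$ implies $|f_n|\xrightarrow{w^*}0$. A norm bounded subset $A$ of a Banach lattice $F$ is an almost limited set if every disjoint weak* null sequence $(f_n)$ in $F^*$ satisfies $\sup_{y\in A}|f_n(y)|\to 0$. An operator $T:X\to F$ from a Banach space into a Banach lattice is weak almost limited if $T$ carries each relatively weakly compact set in $X$ to an almost limited set in $F$. *)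

theory Defs
  imports "HOL-Analysis.Analysis" "HOL-Library.Lattice_Algebras"
begin

section \<open>Banach lattices\<close>

class banach_lattice = banach + ordered_real_vector + lattice_ab_group_add_abs +
  assumes norm_le_if_abs_le: "\<bar>x\<bar> \<le> \<bar>y\<bar> \<Longrightarrow> norm x \<le> norm y"

instance real :: banach_lattice
  by standard (auto simp: abs_if sup_max)

definition solid_hull :: "'a::banach_lattice set \<Rightarrow> 'a set" where
  "solid_hull A = {y. \<exists>x\<in>A. \<bar>y\<bar> \<le> \<bar>x\<bar>}"

definition disjoint_seq :: "(nat \<Rightarrow> 'a::banach_lattice) \<Rightarrow> bool" where
  "disjoint_seq x \<longleftrightarrow> (\<forall>n m. n \<noteq> m \<longrightarrow> inf \<bar>x n\<bar> \<bar>x m\<bar> = 0)"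

definition order_bounded_operator :: "('a::banach_lattice \<Rightarrow>\<^sub>L 'b::banach_lattice) \<Rightarrow> bool" where
  "order_bounded_operator T \<longleftrightarrow> (\<forall>a b. \<exists>c d. blinfun_apply T ` {a..b} \<subseteq> {c..d})"


section \<open>The dual Banach lattice\<close>

text \<open>The norm dual of \<open>'a\<close> is the type \<open>'a \<Rightarrow>\<^sub>L real\<close>. Its order is the dual order, and its lattice
  operations are the suprema and infima for that order; \<open>dual_lattice\<close> below shows that they exist.
  (The type \<open>'a \<Rightarrow>\<^sub>L 'b\<close> is not a lattice for arbitrary \<open>'b\<close>, so the dual cannot be made an instance of
  the lattice classes.)\<close>

definition dual_le :: "('a::banach_lattice \<Rightarrow>\<^sub>L real) \<Rightarrow> ('a \<Rightarrow>\<^sub>L real) \<Rightarrow> bool" where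
  "dual_le f g \<longleftrightarrow> (\<forall>x\<ge>0. blinfun_apply f x \<le> blinfun_apply g x)"

definition dual_less :: "('a::banach_lattice \<Rightarrow>\<^sub>L real) \<Rightarrow> ('a \<Rightarrow>\<^sub>L real) \<Rightarrow> bool" where
  "dual_less f g \<longleftrightarrow> dual_le f g \<and> \<not> dual_le g f"

definition dual_sup :: "('a::banach_lattice \<Rightarrow>\<^sub>L real) \<Rightarrow> ('a \<Rightarrow>\<^sub>L real) \<Rightarrow> ('a \<Rightarrow>\<^sub>L real)" where
  "dual_sup f g =
    (THE h. dual_le f h \<and> dual_le g h \<and> (\<forall>k. dual_le f k \<and> dual_le g k \<longrightarrow> dual_le h k))"

definition dual_inf :: "('a::banach_lattice \<Rightarrow>\<^sub>L real) \<Rightarrow> ('a \<Rightarrow>\<^sub>L real) \<Rightarrow> ('a \<Rightarrow>\<^sub>L real)" where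
  "dual_inf f g =
    (THE h. dual_le h f \<and> dual_le h g \<and> (\<forall>k. dual_le k f \<and> dual_le k g \<longrightarrow> dual_le k h))"

definition dual_abs :: "('a::banach_lattice \<Rightarrow>\<^sub>L real) \<Rightarrow> ('a \<Rightarrow>\<^sub>L real)" where
  "dual_abs f = dual_sup f (- f)"

definition dual_disjoint_seq :: "(nat \<Rightarrow> 'a::banach_lattice \<Rightarrow>\<^sub>L real) \<Rightarrow> bool" where
  "dual_disjoint_seq f \<longleftrightarrow> (\<forall>n m. n \<noteq> m \<longrightarrow> dual_inf (dual_abs (f n)) (dual_abs (f m)) = 0)"

lemma dual_le_refl: "dual_le f f"
  by (simp add: dual_le_def)

lemma dual_le_trans: "dual_le f g \<Longrightarrow> dual_le g h \<Longrightarrow> dual_le f h"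
  unfolding dual_le_def by (meson order_trans)

lemma dual_le_minus_iff: "dual_le (- f) (- g) \<longleftrightarrow> dual_le g f"
  by (simp add: dual_le_def uminus_blinfun.rep_eq)

lemma pprt_add_nprt: "(x::'a::banach_lattice) = pprt x - (- nprt x)"
  using prts[of x] by simp

lemma dual_le_antisym:
  assumes "dual_le f g" "dual_le g f"
  shows "f = g"
proof (rule blinfun_eqI)
  fix x :: 'a
  have eq: "blinfun_apply f y = blinfun_apply g y" if "y \<ge> 0" for y
    using assms that unfolding dual_le_def by (meson order_antisym)
  have "blinfun_apply f (pprt x - (- nprt x)) = blinfun_apply g (pprt x - (- nprt x))"
    unfolding blinfun.diff_right using eq[of "pprt x"] eq[of "- nprt x"] by simp
  then show "blinfun_apply f x = blinfun_apply g x"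
    using pprt_add_nprt[of x] by simp
qed

lemma norm_mono_nonneg:
  fixes x y :: "'a::banach_lattice"
  assumes "0 \<le> x" "x \<le> y"
  shows "norm x \<le> norm y"
  using assms by (intro norm_le_if_abs_le) (simp add: abs_of_nonneg order_trans[OF assms])

text \<open>The Riesz--Kantorovich formula.\<close>

lemma dual_sup_exists:
  fixes f g :: "'a::banach_lattice \<Rightarrow>\<^sub>L real"
  obtains h where "dual_le f h" "dual_le g h"
    "\<And>k. dual_le f k \<Longrightarrow> dual_le g k \<Longrightarrow> dual_le h k"
    "\<And>x. 0 \<le> x \<Longrightarrow>
       blinfun_apply h x = (SUP y\<in>{0..x}. blinfun_apply f y + blinfun_apply g (x - y))"
proof -
  define q where "q x y = blinfun_apply f y + blinfun_apply g (x - y)" for x y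
  define p where "p x = (SUP y\<in>{0..x}. q x y)" for x
  define K where "K = norm f + norm g"
  have K0: "K \<ge> 0" by (simp add: K_def)
  have q_bound: "\<bar>q x y\<bar> \<le> K * norm x" if "y \<in> {0..x}" for x y
  proof -
    have "\<bar>blinfun_apply f y\<bar> \<le> norm f * norm x"
      using norm_blinfun[of f y] norm_mono_nonneg[of y x] that
      by (smt (verit) atLeastAtMost_iff mult_left_mono norm_ge_zero real_norm_def)
    moreover have "\<bar>blinfun_apply g (x - y)\<bar> \<le> norm g * norm x"
      using norm_blinfun[of g "x - y"] norm_mono_nonneg[of "x - y" x] that
      by (smt (verit) atLeastAtMost_iff diff_ge_0_iff_ge diff_le_eq le_add_same_cancel1
          mult_left_mono norm_ge_zero real_norm_def)
    ultimately show ?thesis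
      unfolding q_def K_def by (simp add: algebra_simps)
  qed
  have bdd: "bdd_above (q x ` {0..x})" for x
    by (rule bdd_aboveI[of _ "K * norm x"]) (use q_bound in fastforce)
  have q_le_p: "q x y \<le> p x" if "y \<in> {0..x}" for x y
    unfolding p_def using bdd that by (rule cSUP_upper2[OF _ _ order_refl])
  have p_le: "p x \<le> c" if "0 \<le> x" "\<And>y. y \<in> {0..x} \<Longrightarrow> q x y \<le> c" for x c
    unfolding p_def using that by (intro cSUP_least) auto
  have p_bound: "\<bar>p x\<bar> \<le> K * norm x" if "0 \<le> x" for x
  proof -
    have "p x \<le> K * norm x" using that q_bound by (intro p_le) (auto simp: abs_le_iff)
    moreover have "- (K * norm x) \<le> p x"
      using q_le_p[of 0 x] q_bound[of 0 x] that by auto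
    ultimately show ?thesis by auto
  qed
  have p_add: "p (x + z) = p x + p z" if x: "0 \<le> x" and z: "0 \<le> z" for x z
  proof (rule antisym)
    show "p (x + z) \<le> p x + p z"
    proof (rule p_le)
      show "0 \<le> x + z" using x z by simp
      fix y assume y: "y \<in> {0..x + z}"
      define u where "u = inf y x"
      define v where "v = y - u"
      have u: "u \<in> {0..x}" using x y by (simp add: u_def)
      have "v = sup 0 (y - x)"
        unfolding v_def u_def by (simp add: diff_inf_eq_sup add_sup_distrib_left)
      then have v: "v \<in> {0..z}" using y z by (simp add: diff_le_eq add.commute)
      have "q (x + z) y = q x u + q z v"
        by (simp add: q_def v_def blinfun.add_right blinfun.diff_right)
      then show "q (x + z) y \<le> p x + p z" using q_le_p[OF u] q_le_p[OF v] by simp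
    qed
    have 1: "q x y + q z w \<le> p (x + z)" if "y \<in> {0..x}" "w \<in> {0..z}" for y w
    proof -
      have "q x y + q z w = q (x + z) (y + w)"
        by (simp add: q_def blinfun.add_right blinfun.diff_right)
      moreover have "y + w \<in> {0..x + z}" using that by (auto intro: add_mono)
      ultimately show ?thesis using q_le_p by simp
    qed
    have "p x \<le> p (x + z) - q z w" if "w \<in> {0..z}" for w
      using 1 that x by (intro p_le) (auto simp: le_diff_eq)
    then have "p z \<le> p (x + z) - p x"
      using z by (intro p_le) (auto simp: le_diff_eq add.commute)
    then show "p x + p z \<le> p (x + z)" by simp
  qed
  have p_scale_le: "p (a *\<^sub>R x) \<le> a * p x" if x: "0 \<le> x" and a: "a > 0" for a x
  proof (rule p_le)
    show "0 \<le> a *\<^sub>R x" using x a by (simp add: scaleR_nonneg_nonneg)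
    fix y assume y: "y \<in> {0..a *\<^sub>R x}"
    have "inverse a *\<^sub>R y \<le> inverse a *\<^sub>R (a *\<^sub>R x)"
      using y a by (intro scaleR_left_mono) auto
    then have "inverse a *\<^sub>R y \<in> {0..x}" using y a by (simp add: scaleR_nonneg_nonneg)
    then have "q x (inverse a *\<^sub>R y) \<le> p x" by (rule q_le_p)
    moreover have "q (a *\<^sub>R x) y = a * q x (inverse a *\<^sub>R y)"
      using a by (simp add: q_def blinfun.scaleR_right blinfun.diff_right distrib_left right_diff_distrib
          flip: mult.assoc)
    ultimately show "q (a *\<^sub>R x) y \<le> a * p x" using a by simp
  qed
  have p0: "p 0 = 0" using p_bound[of 0] by simp
  have p_scale: "p (a *\<^sub>R x) = a * p x" if x: "0 \<le> x" and a: "a \<ge> 0" for a x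
  proof (cases "a = 0")
    case False
    then have a: "a > 0" using a by simp
    have "p (inverse a *\<^sub>R (a *\<^sub>R x)) \<le> inverse a * p (a *\<^sub>R x)"
      using x a by (intro p_scale_le) (auto simp: scaleR_nonneg_nonneg)
    then have "a * p x \<le> p (a *\<^sub>R x)" using a by (simp add: field_simps)
    then show ?thesis using p_scale_le[OF x a] by simp
  qed (simp add: p0)
  define h where "h x = p (pprt x) - p (- nprt x)" for x
  have h_diff: "h (u - v) = p u - p v" if "0 \<le> u" "0 \<le> v" for u v
  proof -
    have "pprt (u - v) + v = u + - nprt (u - v)"
      using prts[of "u - v"] by (simp add: algebra_simps)
    then have "p (pprt (u - v)) + p v = p u + p (- nprt (u - v))"
      using p_add[of "pprt (u - v)" v] p_add[of u "- nprt (u - v)"] that by simp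
    then show ?thesis by (simp add: h_def)
  qed
  have h_pos: "h x = p x" if "0 \<le> x" for x
    using h_diff[of x 0] that by (simp add: p0)
  have h_add: "h (x + z) = h x + h z" for x z
  proof -
    have "x + z = (pprt x + pprt z) - (- nprt x + - nprt z)"
      using arg_cong2[OF prts[of x] prts[of z], of "(+)"] by (simp add: algebra_simps)
    then have "h (x + z) = p (pprt x + pprt z) - p (- nprt x + - nprt z)"
      using h_diff[of "pprt x + pprt z" "- nprt x + - nprt z"]
      by (metis add_nonneg_nonneg neg_0_le_iff_le nprt_le_zero zero_le_pprt)
    then show ?thesis
      using p_add[of "pprt x" "pprt z"] p_add[of "- nprt x" "- nprt z"] by (simp add: h_def)
  qed
  have h_neg: "h (- x) = - h x" for x
    using h_add[of x "- x"] h_pos[of 0] by (simp add: p0)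
  have h_scale_pos: "h (a *\<^sub>R x) = a * h x" if "a \<ge> 0" for a x
  proof -
    have "a *\<^sub>R x = a *\<^sub>R pprt x - a *\<^sub>R (- nprt x)"
      using pprt_add_nprt[of x] scaleR_diff_right[of a "pprt x" "- nprt x"] by simp
    then have "h (a *\<^sub>R x) = p (a *\<^sub>R pprt x) - p (a *\<^sub>R (- nprt x))"
      using h_diff[of "a *\<^sub>R pprt x" "a *\<^sub>R (- nprt x)"] that
      by (simp add: scaleR_nonneg_nonneg scaleR_nonneg_nonpos)
    then show ?thesis
      using p_scale[of "pprt x" a] p_scale[of "- nprt x" a] that
      by (simp add: h_def algebra_simps)
  qed
  have h_scale: "h (a *\<^sub>R x) = a * h x" for a x
    using h_scale_pos[of a x] h_scale_pos[of "- a" x] h_neg[of "a *\<^sub>R x"] by (cases "a \<ge> 0") auto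
  have h_bound: "norm (h x) \<le> norm x * (2 * K)" for x
  proof -
    have 1: "norm (pprt x) \<le> norm x" "norm (- nprt x) \<le> norm x"
      by (rule norm_le_if_abs_le; simp add: abs_prts)+
    have "\<bar>p (pprt x)\<bar> \<le> K * norm x" "\<bar>p (- nprt x)\<bar> \<le> K * norm x"
      using p_bound[of "pprt x"] p_bound[of "- nprt x"]
        mult_left_mono[OF 1(1) K0] mult_left_mono[OF 1(2) K0] by auto
    then have "\<bar>p (pprt x) - p (- nprt x)\<bar> \<le> K * norm x + K * norm x" by linarith
    then show ?thesis by (simp add: h_def mult.commute mult.left_commute)
  qed
  have "bounded_linear h"
    by (rule bounded_linear_intro[of _ "2 * K"]) (use h_add h_scale h_bound in auto)
  then have H: "blinfun_apply (Blinfun h) x = h x" for x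
    by (simp add: bounded_linear_Blinfun_apply)
  show thesis
  proof
    show "dual_le f (Blinfun h)"
      unfolding dual_le_def H using q_le_p[of x x for x] by (auto simp: h_pos q_def)
    show "dual_le g (Blinfun h)"
      unfolding dual_le_def H using q_le_p[of 0 x for x] by (auto simp: h_pos q_def)
    show "dual_le (Blinfun h) k" if "dual_le f k" "dual_le g k" for k
      unfolding dual_le_def H
    proof (intro allI impI)
      fix x :: 'a assume x: "0 \<le> x"
      have "p x \<le> blinfun_apply k x"
      proof (rule p_le[OF x])
        fix y assume "y \<in> {0..x}"
        then have "blinfun_apply f y \<le> blinfun_apply k y"
          "blinfun_apply g (x - y) \<le> blinfun_apply k (x - y)"
          using that by (auto simp: dual_le_def)
        then show "q x y \<le> blinfun_apply k x"
          by (simp add: q_def blinfun.diff_right)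
      qed
      then show "h x \<le> blinfun_apply k x" using x by (simp add: h_pos)
    qed
    show "blinfun_apply (Blinfun h) x
        = (SUP y\<in>{0..x}. blinfun_apply f y + blinfun_apply g (x - y))" if "0 \<le> x" for x
      using that by (simp add: H h_pos p_def q_def)
  qed
qed

lemma dual_sup_eqI:
  assumes "dual_le f h" "dual_le g h" "\<And>k. dual_le f k \<Longrightarrow> dual_le g k \<Longrightarrow> dual_le h k"
  shows "dual_sup f g = h"
  unfolding dual_sup_def by (rule the_equality) (use assms dual_le_antisym in blast)+

lemma dual_inf_eqI:
  assumes "dual_le h f" "dual_le h g" "\<And>k. dual_le k f \<Longrightarrow> dual_le k g \<Longrightarrow> dual_le k h"
  shows "dual_inf f g = h"
  unfolding dual_inf_def by (rule the_equality) (use assms dual_le_antisym in blast)+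

lemma dual_sup_apply:
  assumes "0 \<le> x"
  shows "blinfun_apply (dual_sup f g) x
    = (SUP y\<in>{0..x}. blinfun_apply f y + blinfun_apply g (x - y))"
proof -
  obtain h where h: "dual_le f h" "dual_le g h"
    "\<And>k. dual_le f k \<Longrightarrow> dual_le g k \<Longrightarrow> dual_le h k"
    "blinfun_apply h x = (SUP y\<in>{0..x}. blinfun_apply f y + blinfun_apply g (x - y))"
    using dual_sup_exists[of f g] assms by metis
  then show ?thesis using dual_sup_eqI[OF h(1-3)] by simp
qed

lemma dual_sup_lub:
  "dual_le f (dual_sup f g)" "dual_le g (dual_sup f g)"
  "dual_le f k \<Longrightarrow> dual_le g k \<Longrightarrow> dual_le (dual_sup f g) k"
  by (metis dual_sup_exists dual_sup_eqI)+

lemma dual_inf_eq_neg_sup: "dual_inf f g = - dual_sup (- f) (- g)"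
proof (rule dual_inf_eqI)
  show "dual_le (- dual_sup (- f) (- g)) f" "dual_le (- dual_sup (- f) (- g)) g"
    by (metis dual_le_minus_iff dual_sup_lub minus_minus)+
  show "dual_le k (- dual_sup (- f) (- g))" if "dual_le k f" "dual_le k g" for k
    using that by (metis dual_le_minus_iff dual_sup_lub(3) minus_minus)
qed

theorem dual_lattice: "class.lattice dual_inf dual_le dual_less dual_sup"
proof
  show "dual_le (dual_inf f g) f" "dual_le (dual_inf f g) g" for f g :: "'a \<Rightarrow>\<^sub>L real"
    by (metis dual_inf_eq_neg_sup dual_le_minus_iff dual_sup_lub minus_minus)+
  show "dual_le f (dual_inf g h)" if "dual_le f g" "dual_le f h" for f g h :: "'a \<Rightarrow>\<^sub>L real"
    using that by (metis dual_inf_eq_neg_sup dual_le_minus_iff dual_sup_lub(3) minus_minus)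
qed (auto simp: dual_less_def intro: dual_le_refl dual_le_antisym dual_sup_lub
      elim: dual_le_trans)


section \<open>Weak and weak* topologies\<close>

text \<open>On function types \<open>euclidean\<close> is the topology of pointwise convergence.\<close>

definition weak_topology :: "'a::real_normed_vector topology" where
  "weak_topology =
    pullback_topology UNIV (\<lambda>x. \<lambda>f::'a \<Rightarrow>\<^sub>L real. blinfun_apply f x) euclidean"

definition weak_star_topology :: "('a::real_normed_vector \<Rightarrow>\<^sub>L real) topology" where
  "weak_star_topology = pullback_topology UNIV blinfun_apply euclidean"

definition weakly_null :: "(nat \<Rightarrow> 'a::real_normed_vector) \<Rightarrow> bool" where
  "weakly_null x \<longleftrightarrow> limitin weak_topology x 0 sequentially"

definition weak_star_null :: "(nat \<Rightarrow> 'a::real_normed_vector \<Rightarrow>\<^sub>L real) \<Rightarrow> bool" where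
  "weak_star_null f \<longleftrightarrow> limitin weak_star_topology f 0 sequentially"

definition relatively_weakly_compact :: "'a::real_normed_vector set \<Rightarrow> bool" where
  "relatively_weakly_compact A \<longleftrightarrow> compactin weak_topology (weak_topology closure_of A)"

lemma limitin_pullback_UNIV:
  "limitin (pullback_topology UNIV F euclidean) x l net \<longleftrightarrow> ((\<lambda>n. F (x n)) \<longlongrightarrow> F l) net"
proof
  assume *: "limitin (pullback_topology UNIV F euclidean) x l net"
  show "((\<lambda>n. F (x n)) \<longlongrightarrow> F l) net"
  proof (rule topological_tendstoI)
    fix S assume "open S" "F l \<in> S"
    then have "openin (pullback_topology UNIV F euclidean) (F -` S)" "l \<in> F -` S"
      by (auto simp: openin_pullback_topology)
    then show "\<forall>\<^sub>F n in net. F (x n) \<in> S"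
      using * by (auto simp: limitin_def)
  qed
next
  assume *: "((\<lambda>n. F (x n)) \<longlongrightarrow> F l) net"
  show "limitin (pullback_topology UNIV F euclidean) x l net"
    unfolding limitin_def
    using * by (auto simp: openin_pullback_topology topspace_pullback_topology
        dest: topological_tendstoD)
qed

lemma tendsto_fun_iff:
  fixes F :: "'i \<Rightarrow> 'a \<Rightarrow> real"
  shows "(F \<longlongrightarrow> L) net \<longleftrightarrow> (\<forall>x. ((\<lambda>n. F n x) \<longlongrightarrow> L x) net)"
  using limitin_componentwise[of "\<lambda>_. euclidean" UNIV F L net]
  by (simp add: euclidean_product_topology)

lemma weakly_null_iff:
  "weakly_null x \<longleftrightarrow> (\<forall>f::'a::real_normed_vector \<Rightarrow>\<^sub>L real. (\<lambda>n. blinfun_apply f (x n)) \<longlonglongrightarrow> 0)"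
  unfolding weakly_null_def weak_topology_def limitin_pullback_UNIV
  by (simp add: tendsto_fun_iff)

lemma weak_star_null_iff: "weak_star_null f \<longleftrightarrow> (\<forall>x. (\<lambda>n. blinfun_apply (f n) x) \<longlonglongrightarrow> 0)"
  unfolding weak_star_null_def weak_star_topology_def limitin_pullback_UNIV
  by (simp add: tendsto_fun_iff)


section \<open>Weak almost limited operators\<close>

definition seq_weak_star_continuous_lattice_ops :: "'a::banach_lattice itself \<Rightarrow> bool" where
  "seq_weak_star_continuous_lattice_ops _ \<longleftrightarrow>
    (\<forall>f::nat \<Rightarrow> 'a \<Rightarrow>\<^sub>L real. weak_star_null f \<longrightarrow> weak_star_null (\<lambda>n. dual_abs (f n)))"

definition property_d :: "'a::banach_lattice itself \<Rightarrow> bool" where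
  "property_d _ \<longleftrightarrow>
    (\<forall>f::nat \<Rightarrow> 'a \<Rightarrow>\<^sub>L real. dual_disjoint_seq f \<and> weak_star_null f \<longrightarrow>
      weak_star_null (\<lambda>n. dual_abs (f n)))"

text \<open>The supremum is taken in \<open>ennreal\<close>, where the supremum over the empty set is \<open>0\<close>.\<close>

definition almost_limited :: "'a::banach_lattice set \<Rightarrow> bool" where
  "almost_limited A \<longleftrightarrow> bounded A \<and>
    (\<forall>f. dual_disjoint_seq f \<and> weak_star_null f \<longrightarrow>
      (\<lambda>n. SUP y\<in>A. ennreal \<bar>blinfun_apply (f n) y\<bar>) \<longlonglongrightarrow> 0)"

definition weak_almost_limited :: "('x::banach \<Rightarrow>\<^sub>L 'b::banach_lattice) \<Rightarrow> bool" where
  "weak_almost_limited T \<longleftrightarrow>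
    (\<forall>A. relatively_weakly_compact A \<longrightarrow> almost_limited (blinfun_apply T ` A))"

end

theory Submission
  imports Defs
begin

text \<open>
  The link between the conditions is (4) \<open>\<Longrightarrow>\<close> (5). Given a relatively weakly compact \<open>A\<close> and a
  disjoint weak* null sequence \<open>f\<^sub>n\<close>, put \<open>h\<^sub>n = f\<^sub>n \<circ> T\<close>. Then \<open>|h\<^sub>n|\<close> is
  weak* null, directly if the lattice operations of \<open>E\<^sup>*\<close> are continuous, and through \<open>|f\<^sub>n|\<close> and the
  order boundedness of \<open>T\<close> if \<open>F\<close> has property (d). If \<open>h\<^sub>n\<close> did not tend to \<open>0\<close> uniformly on the
  solid hull of \<open>A\<close>, a sequence of positive witnesses could be made disjoint without
  changing the values of \<open>h\<^sub>n\<close> much; but disjoint positive sequences in the solid hull of \<open>A\<close> are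
  weakly null, so (4) gives a contradiction. The weak nullity is reduced to the Schur property of
  \<open>\<ell>\<^sup>1\<close>: for positive \<open>f\<close> and disjoint \<open>u\<^sub>n\<close>, the components of \<open>f\<close> on the bands generated by the
  \<open>u\<^sub>n\<close> add up to at most \<open>f\<close> and so define an operator into \<open>\<ell>\<^sup>1\<close>. The same property, applied to
  norming functionals scaled by \<open>2\<^sup>-\<^sup>n\<close>, shows that weakly compact sets are norm bounded.
\<close>

section \<open>The Hahn--Banach theorem\<close>

text \<open>Only one inequality is required for scaling; applying it to the inverse factor gives
  equality (\<open>sublinear_scale\<close>).\<close>

definition sublinear :: "('a::real_vector \<Rightarrow> real) \<Rightarrow> bool" where
  "sublinear p \<longleftrightarrow> (\<forall>x y. p (x + y) \<le> p x + p y) \<and> (\<forall>a\<ge>0. \<forall>x. p (a *\<^sub>R x) \<le> a * p x)"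

lemma sublinear_add: "sublinear p \<Longrightarrow> p (x + y) \<le> p x + p y"
  by (simp add: sublinear_def)

lemma sublinear_zero:
  assumes "sublinear p"
  shows "p 0 = 0"
proof -
  have "p (0 + 0) \<le> p 0 + p 0" "p (0 *\<^sub>R 0) \<le> 0 * p 0"
    using assms unfolding sublinear_def by blast+
  then show ?thesis by simp
qed

lemma sublinear_scale:
  assumes "sublinear p" "a \<ge> 0"
  shows "p (a *\<^sub>R x) = a * p x"
proof (cases "a = 0")
  case True
  then show ?thesis using sublinear_zero[OF assms(1)] by simp
next
  case False
  then have a: "a > 0" using assms by simp
  have "p (inverse a *\<^sub>R (a *\<^sub>R x)) \<le> inverse a * p (a *\<^sub>R x)"
    using assms a unfolding sublinear_def by (metis inverse_nonnegative_iff_nonnegative)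
  then have "a * p x \<le> p (a *\<^sub>R x)" using a by (simp add: field_simps)
  moreover have "p (a *\<^sub>R x) \<le> a * p x" using assms by (simp add: sublinear_def)
  ultimately show ?thesis by simp
qed

lemma sublinear_neg:
  assumes "sublinear p"
  shows "- p (- x) \<le> p x"
  using sublinear_add[OF assms, of x "- x"] sublinear_zero[OF assms] by simp

text \<open>This plays the part of the one-dimensional extension step of Hahn--Banach. The
  functional \<open>q\<close> is the infimum of \<open>p (x + t *\<^sub>R y) - t * p y\<close> over
  \<open>t \<ge> 0\<close>: \<open>t = 0\<close> shows \<open>q \<le> p\<close>, and
  \<open>t = 1\<close> at \<open>- y\<close> gives the lowered value.\<close>

lemma sublinear_lower:
  fixes p :: "'a::real_vector \<Rightarrow> real"
  assumes p: "sublinear p"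
  obtains q where "sublinear q" "q \<le> p" "q (- y) \<le> - p y"
proof
  define s where "s x t = p (x + t *\<^sub>R y) - t * p y" for x t
  define q where "q x = (INF t\<in>{0..}. s x t)" for x
  \<comment> \<open>The term \<open>t * p y\<close> is \<open>p (t *\<^sub>R y)\<close>, so
    subadditivity bounds \<open>s x\<close> below independently of \<open>t\<close> and the infimum
    is finite.\<close>
  have "- p (- x) \<le> s x t" if "t \<ge> 0" for x t
    using sublinear_add[OF p, of "x + t *\<^sub>R y" "- x"] sublinear_scale[OF p that, of y]
    by (simp add: s_def)
  then have "bdd_below (s x ` {0..})" for x
    by (intro bdd_belowI[of _ "- p (- x)"]) auto
  then have q_le: "q x \<le> s x t" if "t \<ge> 0" for x t
    unfolding q_def using that by (intro cINF_lower) auto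
  have q_ge: "c \<le> q x" if "\<And>t. t \<ge> 0 \<Longrightarrow> c \<le> s x t" for x c
    unfolding q_def using that by (intro cINF_greatest) auto
  have "q (x + z) \<le> q x + q z" for x z
  proof -
    have 1: "q (x + z) \<le> s x t + s z u" if "t \<ge> 0" "u \<ge> 0" for t u
    proof -
      have "q (x + z) \<le> s (x + z) (t + u)" using that by (intro q_le) auto
      also have "\<dots> \<le> s x t + s z u"
        using sublinear_add[OF p, of "x + t *\<^sub>R y" "z + u *\<^sub>R y"] by (simp add: s_def algebra_simps)
      finally show ?thesis .
    qed
    have "q (x + z) - s z u \<le> q x" if "u \<ge> 0" for u
      using 1 that by (intro q_ge) (simp add: diff_le_eq)
    then have "q (x + z) - q x \<le> q z"
      by (intro q_ge) (simp add: algebra_simps)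
    then show ?thesis by simp
  qed
  moreover have "q (a *\<^sub>R x) \<le> a * q x" if "a \<ge> 0" for a x
  proof (cases "a = 0")
    case True
    then show ?thesis using q_le[of 0 0] sublinear_zero[OF p] by (simp add: s_def)
  next
    case False
    then have a: "a > 0" using that by simp
    have "q (a *\<^sub>R x) \<le> a * s x t" if "t \<ge> 0" for t
      using q_le[of "a * t" "a *\<^sub>R x"] sublinear_scale[OF p, of a "x + t *\<^sub>R y"] a that
      by (simp add: s_def algebra_simps)
    then have "q (a *\<^sub>R x) / a \<le> q x"
      using a by (intro q_ge) (simp add: field_simps)
    then show ?thesis using a by (simp add: field_simps)
  qed
  ultimately show "sublinear q" by (simp add: sublinear_def)
  show "q \<le> p" using q_le[of 0] by (auto simp: le_fun_def s_def)
  show "q (- y) \<le> - p y" using q_le[of 1 "- y"] sublinear_zero[OF p] by (simp add: s_def)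
qed

text \<open>The pointwise infimum works: the common majorant \<open>p\<close> keeps it above
  \<open>- p (- x)\<close>, and for subadditivity two members \<open>q\<close> and \<open>r\<close>
  are both replaced by the smaller one, which exists in a chain.\<close>

lemma sublinear_chain_lower_bound:
  fixes p :: "'a::real_vector \<Rightarrow> real"
  assumes C: "\<And>q. q \<in> C \<Longrightarrow> sublinear q \<and> q \<le> p" and ne: "C \<noteq> {}"
    and chain: "\<And>q r. q \<in> C \<Longrightarrow> r \<in> C \<Longrightarrow> q \<le> r \<or> r \<le> q"
  obtains u where "sublinear u" "\<And>q. q \<in> C \<Longrightarrow> u \<le> q"
proof
  define u where "u x = (INF q\<in>C. q x)" for x
  have "- p (- x) \<le> q x" if "q \<in> C" for q x
    using sublinear_neg[of q x] C[OF that] by (smt (verit) le_fun_def)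
  then have "bdd_below ((\<lambda>q. q x) ` C)" for x
    by (intro bdd_belowI[of _ "- p (- x)"]) auto
  then have u_le: "u x \<le> q x" if "q \<in> C" for q x
    unfolding u_def using that by (intro cINF_lower)
  have u_ge: "c \<le> u x" if "\<And>q. q \<in> C \<Longrightarrow> c \<le> q x" for x c
    unfolding u_def using that ne by (intro cINF_greatest) auto
  have "u (x + z) \<le> u x + u z" for x z
  proof -
    have 1: "u (x + z) \<le> q x + r z" if "q \<in> C" "r \<in> C" for q r
      using chain[OF that] u_le[OF that(1), of "x + z"] u_le[OF that(2), of "x + z"]
        sublinear_add[of q x z] sublinear_add[of r x z] C[OF that(1)] C[OF that(2)]
      unfolding le_fun_def by (smt (verit))
    have "u (x + z) - r z \<le> u x" if "r \<in> C" for r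
      using 1 that by (intro u_ge) (simp add: diff_le_eq)
    then have "u (x + z) - u x \<le> u z"
      by (intro u_ge) (simp add: algebra_simps)
    then show ?thesis by simp
  qed
  moreover have "u (a *\<^sub>R x) \<le> a * u x" if "a \<ge> 0" for a x
  proof (cases "a = 0")
    case True
    then show ?thesis using u_le[of _ 0] ne C sublinear_zero by fastforce
  next
    case False
    then have a: "a > 0" using that by simp
    have "u (a *\<^sub>R x) \<le> a * q x" if "q \<in> C" for q
      using u_le[OF that, of "a *\<^sub>R x"] sublinear_scale[of q a x] C[OF that] a by simp
    then have "u (a *\<^sub>R x) / a \<le> u x"
      using a by (intro u_ge) (simp add: field_simps)
    then show ?thesis using a by (simp add: field_simps)
  qed
  ultimately show "sublinear u" by (simp add: sublinear_def)
  show "u \<le> q" if "q \<in> C" for q using u_le[OF that] by (simp add: le_fun_def)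
qed

text \<open>A minimal sublinear functional cannot be lowered in any direction, hence is linear.\<close>

lemma sublinear_dominates_linear:
  fixes p :: "'a::real_vector \<Rightarrow> real"
  assumes p: "sublinear p"
  obtains f where "linear f" "f \<le> p"
proof -
  define S where "S = {q. sublinear q \<and> q \<le> p}"
  have "\<exists>m\<in>S. \<forall>q\<in>S. q \<le> m \<longrightarrow> q = m"
  \<comment> \<open>The order is reversed because Zorn's lemma yields a maximal element and a
    minimal functional is wanted.\<close>
  proof (rule predicate_Zorn)
    show "partial_order_on S (relation_of (\<lambda>q r. r \<le> q) S)"
      by (rule partial_order_on_relation_ofI) auto
    fix C assume C: "C \<in> Chains (relation_of (\<lambda>q r. r \<le> q) S)"
    then have chain: "q \<le> r \<or> r \<le> q" if "q \<in> C" "r \<in> C" for q r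
      using that by (auto simp: Chains_def relation_of_def)
    show "\<exists>u\<in>S. \<forall>q\<in>C. u \<le> q"
    proof (cases "C = {}")
      case True
      then show ?thesis using p by (auto simp: S_def)
    next
      case False
      have "sublinear q \<and> q \<le> p" if "q \<in> C" for q
        using C that unfolding Chains_def relation_of_def S_def by blast
      then obtain u where u: "sublinear u" "\<And>q. q \<in> C \<Longrightarrow> u \<le> q"
        using sublinear_chain_lower_bound[of C p] False chain by metis
      moreover have "u \<le> p"
        using False u(2) \<open>\<And>q. q \<in> C \<Longrightarrow> sublinear q \<and> q \<le> p\<close> order_trans by blast
      ultimately show ?thesis by (auto simp: S_def)
    qed
  qed
  then obtain m where m: "sublinear m" "m \<le> p"
    and min: "\<And>q. sublinear q \<Longrightarrow> q \<le> m \<Longrightarrow> q = m"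
    unfolding S_def using order_trans by blast
  have neg: "m (- y) = - m y" for y
    using sublinear_lower[OF m(1), of y] min sublinear_neg[OF m(1), of "- y"]
    by (metis minus_le_iff order_antisym minus_minus)
  have "linear m"
  proof (rule linearI)
    show "m (x + y) = m x + m y" for x y
      using sublinear_add[OF m(1), of x y] sublinear_add[OF m(1), of "- x" "- y"]
        neg[of "x + y"] neg[of x] neg[of y] by simp
    show "m (a *\<^sub>R x) = a *\<^sub>R m x" for a x
      using sublinear_scale[OF m(1), of a x] sublinear_scale[OF m(1), of "- a" x] neg[of "a *\<^sub>R x"]
      by (cases "a \<ge> 0") auto
  qed
  then show thesis using that m(2) by blast
qed

text \<open>Before a linear functional is taken below \<open>p\<close>, the functional
  \<open>p\<close> is lowered at \<open>- y\<close>. This forces \<open>f (- y) \<le> - p y\<close>,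
  so \<open>f\<close> attains \<open>p\<close> at \<open>y\<close>; the norm bound on
  \<open>p\<close> makes \<open>f\<close> continuous.\<close>

lemma hahn_banach_sublinear:
  fixes p :: "'a::real_normed_vector \<Rightarrow> real"
  assumes p: "sublinear p" and K: "\<And>x. p x \<le> K * norm x"
  obtains f :: "'a \<Rightarrow>\<^sub>L real" where "\<And>x. blinfun_apply f x \<le> p x" "blinfun_apply f y = p y"
proof -
  obtain q where q: "sublinear q" "q \<le> p" "q (- y) \<le> - p y"
    using sublinear_lower[OF p] .
  obtain f where f: "linear f" "f \<le> q"
    using sublinear_dominates_linear[OF q(1)] .
  have le: "f x \<le> p x" for x
    using f(2) q(2) by (meson le_fun_def order_trans)
  have "bounded_linear f"
  proof (rule bounded_linear_intro[of _ K])
    show "norm (f x) \<le> norm x * K" for x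
      using le[of x] le[of "- x"] K[of x] K[of "- x"] linear_neg[OF f(1), of x]
      by (simp add: abs_le_iff mult.commute)
  qed (use f(1) in \<open>auto simp: linear_add linear_scale\<close>)
  then have F: "blinfun_apply (Blinfun f) x = f x" for x
    by (simp add: bounded_linear_Blinfun_apply)
  have "f (- y) \<le> - p y" using f(2) q(3) by (meson le_fun_def order_trans)
  then have "f y = p y" using le[of y] linear_neg[OF f(1), of y] by simp
  then show thesis using that[of "Blinfun f"] le by (simp add: F)
qed

lemma norming_functional:
  fixes y :: "'a::real_normed_vector"
  obtains f :: "'a \<Rightarrow>\<^sub>L real" where "\<And>x. \<bar>blinfun_apply f x\<bar> \<le> norm x" "blinfun_apply f y = norm y"
proof -
  have "sublinear (norm :: 'a \<Rightarrow> real)"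
    by (simp add: sublinear_def norm_triangle_ineq)
  then obtain f :: "'a \<Rightarrow>\<^sub>L real"
    where f: "\<And>x. blinfun_apply f x \<le> norm x" "blinfun_apply f y = norm y"
    by (rule hahn_banach_sublinear[of norm 1 y]) auto
  have "\<bar>blinfun_apply f x\<bar> \<le> norm x" for x
    using f(1)[of x] f(1)[of "- x"] by (simp add: blinfun.minus_right)
  then show thesis using that f(2) by blast
qed

section \<open>Relatively weakly compact sets\<close>

text \<open>If every \<open>l\<close> had a weak neighbourhood that \<open>y\<close> eventually
  leaves, finitely many of these would cover the compact closure of \<open>A\<close> and
  \<open>y\<close> would eventually leave them all. The result is a cluster point rather than a
  convergent subsequence; control over finitely many functionals at a time suffices below.\<close>

lemma relatively_weakly_compact_cluster:
  fixes A :: "'a::real_normed_vector set" and y :: "nat \<Rightarrow> 'a"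
  assumes A: "relatively_weakly_compact A" and y: "\<And>n. y n \<in> A"
  obtains l where "\<And>(F :: ('a \<Rightarrow>\<^sub>L real) set) \<delta> N. finite F \<Longrightarrow> \<delta> > 0 \<Longrightarrow>
     \<exists>n\<ge>N. \<forall>f\<in>F. \<bar>blinfun_apply f (y n) - blinfun_apply f l\<bar> < \<delta>"
proof (rule ccontr)
  assume *: "\<not> thesis"
  define W where "W = (weak_topology :: 'a topology)"
  have top: "topspace W = UNIV"
    by (simp add: W_def weak_topology_def topspace_pullback_topology)
  define K where "K = W closure_of A"
  have K: "compactin W K" and AK: "A \<subseteq> K"
    using A closure_of_subset[of A W] by (auto simp: relatively_weakly_compact_def W_def K_def top[unfolded W_def])
  define U where "U F \<delta> l = {x. \<forall>f\<in>F. \<bar>blinfun_apply f x - blinfun_apply f l\<bar> < \<delta>}"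
    for F :: "('a \<Rightarrow>\<^sub>L real) set" and \<delta> :: real and l :: 'a
  have U_open: "openin W (U F \<delta> l)" if "finite F" for F \<delta> l
  proof -
    define V where "V = {\<phi>::('a \<Rightarrow>\<^sub>L real) \<Rightarrow> real. \<forall>f\<in>F. \<bar>\<phi> f - blinfun_apply f l\<bar> < \<delta>}"
    have "V = (\<Inter>f\<in>F. {\<phi>. \<bar>\<phi> f - blinfun_apply f l\<bar> < \<delta>})"
      by (auto simp: V_def)
    moreover have "open {\<phi>::('a \<Rightarrow>\<^sub>L real) \<Rightarrow> real. \<bar>\<phi> f - blinfun_apply f l\<bar> < \<delta>}" for f
      by (intro open_Collect_less continuous_intros continuous_on_product_coordinates)
    ultimately have "open V" using that by auto
    moreover have "U F \<delta> l = (\<lambda>x f. blinfun_apply f x) -` V"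
      by (auto simp: U_def V_def)
    ultimately show ?thesis
      by (auto simp: W_def weak_topology_def openin_pullback_topology)
  qed
  have "\<exists>F \<delta> N. finite F \<and> \<delta> > 0 \<and> (\<forall>n\<ge>N. y n \<notin> U F \<delta> l)" for l
    using * that[of l] unfolding U_def by blast
  then obtain F \<delta> N where FN: "\<And>l. finite (F l)" "\<And>l. \<delta> l > 0" "\<And>l n. n \<ge> N l \<Longrightarrow> y n \<notin> U (F l) (\<delta> l) l"
    by metis
  have "\<exists>\<D>. finite \<D> \<and> \<D> \<subseteq> (\<lambda>l. U (F l) (\<delta> l) l) ` UNIV \<and> K \<subseteq> \<Union>\<D>"
  proof (rule compactinD[OF K])
    show "K \<subseteq> \<Union> (range (\<lambda>l. U (F l) (\<delta> l) l))"
    proof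
      fix x
      have "x \<in> U (F x) (\<delta> x) x" using FN(2) by (simp add: U_def)
      then show "x \<in> \<Union> (range (\<lambda>l. U (F l) (\<delta> l) l))" by blast
    qed
  qed (use FN(1) U_open in auto)
  then obtain \<D> where \<D>: "finite \<D>" "\<D> \<subseteq> (\<lambda>l. U (F l) (\<delta> l) l) ` UNIV" "K \<subseteq> \<Union>\<D>"
    by blast
  obtain L where "finite L" "\<D> = (\<lambda>l. U (F l) (\<delta> l) l) ` L"
    using finite_subset_image[OF \<D>(1,2)] by blast
  then have L: "finite L" "K \<subseteq> (\<Union>l\<in>L. U (F l) (\<delta> l) l)"
    using \<D>(3) by auto
  \<comment> \<open>From this index on the sequence avoids every set of the finite cover; the
    inserted \<open>0\<close> makes the maximum meaningful for empty \<open>L\<close>.\<close>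
  define n where "n = Max (insert 0 (N ` L))"
  have "N l \<le> n" if "l \<in> L" for l
    using that L(1) by (auto simp: n_def)
  then show False using FN(3) L(2) y AK by blast
qed

lemma sum_subsequence_le:
  fixes a :: "nat \<Rightarrow> real" and s :: "nat \<Rightarrow> nat"
  assumes s: "strict_mono s" and a: "\<And>n. 0 \<le> a n"
  shows "(\<Sum>n<N. a (s n)) \<le> (\<Sum>n<s N. a n)"
proof -
  have "(\<Sum>n<N. a (s n)) = sum a (s ` {..<N})"
    using strict_mono_imp_inj_on[OF s, of "{..<N}"] by (simp add: sum.reindex)
  also have "\<dots> \<le> (\<Sum>n<s N. a n)"
    using a strict_monoD[OF s] by (intro sum_mono2) auto
  finally show ?thesis .
qed

text \<open>Gliding hump: along a suitable subsequence \<open>r\<close> with weak cluster point \<open>l\<close>, the functional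
  \<open>\<phi> = \<Sum>\<^sub>i g\<^bsub>r i\<^esub>\<close> takes values at \<open>y\<^bsub>r n\<^esub> - l\<close> that are dominated by the diagonal term. The
  subsequence may have a different cluster point \<open>l'\<close>, but \<open>\<phi>\<close> does not distinguish it from \<open>l\<close>.\<close>

lemma weakly_compact_diagonal_small:
  fixes g :: "nat \<Rightarrow> 'a::real_normed_vector \<Rightarrow>\<^sub>L real"
  assumes A: "relatively_weakly_compact A" and y: "\<And>n. y n \<in> A"
    and C: "\<And>N x. (\<Sum>n<N. \<bar>blinfun_apply (g n) x\<bar>) \<le> C * norm x"
    and \<epsilon>: "\<epsilon> > 0"
  shows "\<exists>n. \<bar>blinfun_apply (g n) (y n)\<bar> < \<epsilon>"
proof (rule ccontr)
  assume "\<not> ?thesis"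
  then have big: "\<epsilon> \<le> \<bar>blinfun_apply (g n) (y n)\<bar>" for n by (meson not_less)
  have summ: "summable (\<lambda>n. \<bar>blinfun_apply (g n) x\<bar>)" for x
    by (rule summableI_nonneg_bounded[where x = "C * norm x"]) (use C in auto)
  obtain l where l: "\<And>(F :: ('a \<Rightarrow>\<^sub>L real) set) \<delta> N. finite F \<Longrightarrow> \<delta> > 0 \<Longrightarrow>
     \<exists>n\<ge>N. \<forall>f\<in>F. \<bar>blinfun_apply f (y n) - blinfun_apply f l\<bar> < \<delta>"
    using relatively_weakly_compact_cluster[of A y] A y by blast
  define z where "z n = y n - l" for n
  obtain N0 where N0: "\<And>n. n \<ge> N0 \<Longrightarrow> \<bar>blinfun_apply (g n) l\<bar> < \<epsilon> / 4"
    using LIMSEQ_D[OF summable_LIMSEQ_zero[OF summ[of l]], of "\<epsilon> / 4"] \<epsilon> by auto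
  \<comment> \<open>The new index is chosen so that all functionals up to the old index are small at
    the new point, and the functionals from the new index on have a small sum at all old points. The
    divisor \<open>real n + 1\<close> makes the first bound tend to \<open>0\<close>, which later
    identifies the values at the two cluster points.\<close>
  have "\<exists>r. \<forall>n. N0 \<le> r n \<and> (r n < r (Suc n) \<and>
      (\<Sum>i\<le>r n. \<bar>blinfun_apply (g i) (z (r (Suc n)))\<bar>) < \<epsilon> / 8 / (real n + 1) \<and>
      (\<forall>m\<le>r n. (\<Sum>i. \<bar>blinfun_apply (g (i + r (Suc n))) (z m)\<bar>) < \<epsilon> / 8))"
  proof (rule dependent_nat_choice)
    show "\<exists>k. N0 \<le> k" by blast
    fix k n assume k: "N0 \<le> k"
    have "\<forall>m\<in>{..k}. \<forall>\<^sub>F N in sequentially. (\<Sum>i. \<bar>blinfun_apply (g (i + N)) (z m)\<bar>) < \<epsilon> / 8"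
    proof
      fix m
      obtain N where "\<And>n. n \<ge> N \<Longrightarrow> norm (\<Sum>i. \<bar>blinfun_apply (g (i + n)) (z m)\<bar>) < \<epsilon> / 8"
        using suminf_exist_split[OF _ summ[of "z m"], of "\<epsilon> / 8"] \<epsilon> by auto
      then show "\<forall>\<^sub>F N in sequentially. (\<Sum>i. \<bar>blinfun_apply (g (i + N)) (z m)\<bar>) < \<epsilon> / 8"
        unfolding eventually_sequentially real_norm_def by (meson abs_ge_self le_less_trans)
    qed
    then have "\<forall>\<^sub>F N in sequentially. \<forall>m\<in>{..k}. (\<Sum>i. \<bar>blinfun_apply (g (i + N)) (z m)\<bar>) < \<epsilon> / 8"
      by (intro eventually_ball_finite) auto
    then obtain M where M: "\<And>N m. N \<ge> M \<Longrightarrow> m \<le> k \<Longrightarrow>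
        (\<Sum>i. \<bar>blinfun_apply (g (i + N)) (z m)\<bar>) < \<epsilon> / 8"
      unfolding eventually_sequentially by auto
    define \<delta> where "\<delta> = \<epsilon> / 8 / (real n + 1) / (real k + 1)"
    have "\<delta> > 0" using \<epsilon> by (simp add: \<delta>_def)
    then obtain k' where k': "k' \<ge> max M (Suc k)" "\<forall>f\<in>g ` {..k}. \<bar>blinfun_apply f (y k') - blinfun_apply f l\<bar> < \<delta>"
      using l[of "g ` {..k}" \<delta> "max M (Suc k)"] by auto
    have "(\<Sum>i\<le>k. \<bar>blinfun_apply (g i) (z k')\<bar>) < (\<Sum>i\<le>k. \<delta>)"
      using k'(2) by (intro sum_strict_mono) (auto simp: z_def blinfun.diff_right)
    also have "\<dots> = \<epsilon> / 8 / (real n + 1)"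
      by (simp add: \<delta>_def add.commute)
    finally show "\<exists>k'. N0 \<le> k' \<and> (k < k' \<and>
      (\<Sum>i\<le>k. \<bar>blinfun_apply (g i) (z k')\<bar>) < \<epsilon> / 8 / (real n + 1) \<and>
      (\<forall>m\<le>k. (\<Sum>i. \<bar>blinfun_apply (g (i + k')) (z m)\<bar>) < \<epsilon> / 8))"
      using k k'(1) M by (intro exI[of _ k']) auto
  qed
  then obtain r where rN0: "\<And>n. N0 \<le> r n" and r_less: "\<And>n. r n < r (Suc n)"
    and r_head: "\<And>n. (\<Sum>i\<le>r n. \<bar>blinfun_apply (g i) (z (r (Suc n)))\<bar>) < \<epsilon> / 8 / (real n + 1)"
    and r_tail: "\<And>n m. m \<le> r n \<Longrightarrow> (\<Sum>i. \<bar>blinfun_apply (g (i + r (Suc n))) (z m)\<bar>) < \<epsilon> / 8"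
    by metis
  have r: "strict_mono r" using r_less by (simp add: strict_mono_Suc_iff)
  \<comment> \<open>Writing the subseries with the indicator of \<open>range r\<close> keeps the
    original indices, so the head and tail estimates apply directly.\<close>
  define c :: "nat \<Rightarrow> real" where "c i = (if i \<in> range r then 1 else 0)" for i
  define \<phi> where "\<phi> x = (\<Sum>i. c i * blinfun_apply (g i) x)" for x
  have cle: "\<bar>c i * b\<bar> \<le> \<bar>b\<bar>" for i b by (simp add: c_def)
  have csumm_abs: "summable (\<lambda>i. \<bar>c i * blinfun_apply (g i) x\<bar>)" for x
    by (rule summable_comparison_test'[OF summ[of x], of 0]) (simp add: cle)
  then have csumm: "summable (\<lambda>i. c i * blinfun_apply (g i) x)" for x
    by (rule summable_rabs_cancel)
  have "bounded_linear \<phi>"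
  proof (rule bounded_linear_intro[of _ C])
    show "\<phi> (x + w) = \<phi> x + \<phi> w" for x w
      by (simp add: \<phi>_def suminf_add[OF csumm csumm] blinfun.add_right distrib_left)
    show "\<phi> (a *\<^sub>R x) = a *\<^sub>R \<phi> x" for a x
      by (simp add: \<phi>_def suminf_mult[OF csumm, symmetric] blinfun.scaleR_right mult.left_commute)
    show "norm (\<phi> x) \<le> norm x * C" for x
    proof -
      have "(\<Sum>i<n. \<bar>c i * blinfun_apply (g i) x\<bar>) \<le> C * norm x" for n
        using sum_mono[of "{..<n}", OF cle] C[of x n] by (meson order_trans)
      then have "(\<Sum>i. \<bar>c i * blinfun_apply (g i) x\<bar>) \<le> C * norm x"
        by (intro suminf_le_const csumm_abs)
      then show ?thesis
        using summable_rabs[OF csumm_abs, of x] by (simp add: \<phi>_def mult.commute)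
    qed
  qed
  then have \<Phi>: "blinfun_apply (Blinfun \<phi>) = \<phi>" by (simp add: bounded_linear_Blinfun_apply)
  \<comment> \<open>Below \<open>N\<close> only \<open>k\<close> and indices up to
    \<open>r n\<close> can have a nonzero coefficient. The diagonal term is at least
    \<open>3 * \<epsilon> / 4\<close>, and head and tail take away at most
    \<open>\<epsilon> / 8\<close> each.\<close>
  have hump: "\<epsilon> / 2 \<le> \<bar>\<phi> (z (r (Suc n)))\<bar>" for n
  proof -
    define k where "k = r (Suc n)"
    define N where "N = r (Suc (Suc n))"
    define t where "t i = c i * blinfun_apply (g i) (z k)" for i
    have "\<phi> (z k) = (\<Sum>i. t (i + N)) + (\<Sum>i<N. t i)"
      using suminf_split_initial_segment[OF csumm[of "z k"]] by (simp add: \<phi>_def t_def)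
    moreover have "(\<Sum>i<N. t i) = (\<Sum>i\<in>insert k {..r n}. t i)"
    proof (rule sum.mono_neutral_right)
      show "insert k {..r n} \<subseteq> {..<N}"
        using r_less[of n] r_less[of "Suc n"] by (auto simp: k_def N_def)
      show "\<forall>i\<in>{..<N} - insert k {..r n}. t i = 0"
      proof
        fix i assume i: "i \<in> {..<N} - insert k {..r n}"
        have "i \<noteq> r m" for m
        proof
          assume im: "i = r m"
          then have "m < Suc (Suc n)" using i strict_mono_less[OF r] by (auto simp: N_def)
          then have "m = Suc n \<or> m \<le> n" by auto
          then show False using i im strict_mono_less_eq[OF r] by (auto simp: k_def)
        qed
        then show "t i = 0" by (auto simp: t_def c_def)
      qed
    qed simp
    moreover have "\<dots> = blinfun_apply (g k) (z k) + (\<Sum>i\<le>r n. t i)"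
      using r_less[of n] by (simp add: t_def c_def k_def)
    moreover have "\<bar>\<Sum>i\<le>r n. t i\<bar> \<le> \<epsilon> / 8"
    proof -
      have "\<bar>\<Sum>i\<le>r n. t i\<bar> \<le> (\<Sum>i\<le>r n. \<bar>blinfun_apply (g i) (z k)\<bar>)"
        unfolding t_def by (intro order_trans[OF sum_abs] sum_mono cle)
      also have "\<dots> \<le> \<epsilon> / 8 / (real n + 1)" using r_head[of n] by (simp add: k_def)
      also have "\<dots> \<le> \<epsilon> / 8" using \<epsilon> by (simp add: divide_le_eq)
      finally show ?thesis .
    qed
    moreover have "\<bar>\<Sum>i. t (i + N)\<bar> \<le> \<epsilon> / 8"
    proof -
      have s: "summable (\<lambda>i. \<bar>t (i + N)\<bar>)"
        using csumm_abs summable_iff_shift[of "\<lambda>i. \<bar>t i\<bar>" N] by (simp add: t_def)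
      have "\<bar>\<Sum>i. t (i + N)\<bar> \<le> (\<Sum>i. \<bar>t (i + N)\<bar>)" by (rule summable_rabs[OF s])
      also have "\<dots> \<le> (\<Sum>i. \<bar>blinfun_apply (g (i + N)) (z k)\<bar>)"
        using s summable_iff_shift[of "\<lambda>i. \<bar>blinfun_apply (g i) (z k)\<bar>" N] summ
        by (intro suminf_le) (auto simp: t_def cle)
      also have "\<dots> \<le> \<epsilon> / 8" using r_tail[of k "Suc n"] by (simp add: k_def N_def)
      finally show ?thesis .
    qed
    moreover have "3 * \<epsilon> / 4 \<le> \<bar>blinfun_apply (g k) (z k)\<bar>"
      unfolding z_def blinfun.diff_right
      using big[of k] N0[OF rN0[of "Suc n"], folded k_def] by linarith
    ultimately show ?thesis unfolding k_def[symmetric] by linarith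
  qed
  obtain l' where l': "\<And>(F :: ('a \<Rightarrow>\<^sub>L real) set) \<delta> N. finite F \<Longrightarrow> \<delta> > 0 \<Longrightarrow>
     \<exists>n\<ge>N. \<forall>f\<in>F. \<bar>blinfun_apply f (y (r n)) - blinfun_apply f l'\<bar> < \<delta>"
    using relatively_weakly_compact_cluster[of A "\<lambda>n. y (r n)"] A y by blast
  \<comment> \<open>By the head bounds the values of \<open>g (r i)\<close> at
    \<open>y (r n)\<close> converge to its value at \<open>l\<close>, while they also cluster at its
    value at \<open>l'\<close>.\<close>
  have "blinfun_apply (g (r i)) l' = blinfun_apply (g (r i)) l" for i
  proof (rule ccontr)
    assume "blinfun_apply (g (r i)) l' \<noteq> blinfun_apply (g (r i)) l"
    define \<delta> where "\<delta> = \<bar>blinfun_apply (g (r i)) l' - blinfun_apply (g (r i)) l\<bar> / 2"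
    have \<delta>: "\<delta> > 0" using \<open>_ \<noteq> _\<close> by (simp add: \<delta>_def)
    obtain N where N: "\<epsilon> / 8 / \<delta> < real N" using reals_Archimedean2 by blast
    obtain n where n: "n \<ge> Suc (max i N)" "\<bar>blinfun_apply (g (r i)) (y (r n)) - blinfun_apply (g (r i)) l'\<bar> < \<delta>"
      using l'[of "{g (r i)}" \<delta> "Suc (max i N)"] \<delta> by auto
    then obtain m where m: "n = Suc m" "i \<le> m" "N \<le> m" by (cases n) auto
    have "\<bar>blinfun_apply (g (r i)) (z (r n))\<bar> \<le> (\<Sum>i\<le>r m. \<bar>blinfun_apply (g i) (z (r n))\<bar>)"
      using m(2) strict_mono_less_eq[OF r] by (intro member_le_sum) auto
    also have "\<dots> < \<epsilon> / 8 / (real m + 1)" using r_head[of m] m by simp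
    also have "\<dots> \<le> \<delta>"
    proof -
      have "\<epsilon> / 8 / \<delta> \<le> real m + 1" using N m(3) by linarith
      then show ?thesis using \<delta> by (simp add: field_simps)
    qed
    finally have "\<bar>blinfun_apply (g (r i)) (y (r n)) - blinfun_apply (g (r i)) l\<bar> < \<delta>"
      by (simp add: z_def blinfun.diff_right)
    with n(2) show False unfolding \<delta>_def by argo
  qed
  then have "\<phi> l' = \<phi> l"
    unfolding \<phi>_def by (intro suminf_cong) (auto simp: c_def)
  \<comment> \<open>The estimate \<open>hump\<close> concerns indices of the form
    \<open>r (Suc n)\<close>, hence the demand that \<open>n\<close> be positive.\<close>
  moreover obtain n where "n \<ge> Suc 0" "\<bar>\<phi> (y (r n)) - \<phi> l'\<bar> < \<epsilon> / 2"
    using l'[of "{Blinfun \<phi>}" "\<epsilon> / 2" "Suc 0"] \<epsilon> by (auto simp: \<Phi>)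
  moreover have "\<phi> (z k) = \<phi> (y k) - \<phi> l" for k
    using blinfun.diff_right[of "Blinfun \<phi>" "y k" l] by (simp add: \<Phi> z_def)
  ultimately show False using hump[of "n - 1"] by simp
qed

text \<open>A form of the Schur property: \<open>x \<mapsto> (g\<^sub>n x)\<^sub>n\<close> is a bounded operator into \<open>\<ell>\<^sup>1\<close>.\<close>

lemma weakly_compact_diagonal_null:
  fixes g :: "nat \<Rightarrow> 'a::real_normed_vector \<Rightarrow>\<^sub>L real"
  assumes A: "relatively_weakly_compact A" and y: "\<And>n. y n \<in> A"
    and C: "\<And>N x. (\<Sum>n<N. \<bar>blinfun_apply (g n) x\<bar>) \<le> C * norm x"
  shows "(\<lambda>n. blinfun_apply (g n) (y n)) \<longlonglongrightarrow> 0"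
proof (rule ccontr)
  assume "\<not> ?thesis"
  then obtain \<epsilon> where \<epsilon>: "\<epsilon> > 0" "\<And>N. \<exists>n\<ge>N. \<epsilon> \<le> \<bar>blinfun_apply (g n) (y n)\<bar>"
    unfolding LIMSEQ_iff by (metis diff_zero not_less real_norm_def)
  then have "infinite {n. \<epsilon> \<le> \<bar>blinfun_apply (g n) (y n)\<bar>}"
    unfolding infinite_nat_iff_unbounded_le by auto
  then obtain s :: "nat \<Rightarrow> nat" where s: "strict_mono s" "\<And>n. \<epsilon> \<le> \<bar>blinfun_apply (g (s n)) (y (s n))\<bar>"
    using infinite_enumerate by blast
  have "\<exists>n. \<bar>blinfun_apply (g (s n)) (y (s n))\<bar> < \<epsilon>"
  proof (rule weakly_compact_diagonal_small[OF A y _ \<epsilon>(1)])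
    show "(\<Sum>n<N. \<bar>blinfun_apply (g (s n)) x\<bar>) \<le> C * norm x" for N x
      using sum_subsequence_le[OF s(1), of "\<lambda>n. \<bar>blinfun_apply (g n) x\<bar>" N] C[of x "s N"] by auto
  qed
  then show False using s(2) by (meson not_less)
qed

text \<open>If points \<open>y n\<close> of \<open>A\<close> had norm above \<open>2 ^ n\<close>,
  norming functionals scaled by \<open>(1 / 2) ^ n\<close> would satisfy the summability bound with
  constant \<open>2\<close> and yet stay above \<open>1\<close> on the diagonal.\<close>

lemma relatively_weakly_compact_imp_bounded:
  fixes A :: "'a::real_normed_vector set"
  assumes A: "relatively_weakly_compact A"
  shows "bounded A"
proof (rule ccontr)
  assume "\<not> bounded A"
  then have "\<exists>y\<in>A. 2 ^ n < norm y" for n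
    unfolding bounded_iff by (meson not_less)
  then obtain y where y: "\<And>n. y n \<in> A" "\<And>n. 2 ^ n < norm (y n)" by metis
  have "\<exists>f :: 'a \<Rightarrow>\<^sub>L real. (\<forall>x. \<bar>blinfun_apply f x\<bar> \<le> norm x) \<and> blinfun_apply f (y n) = norm (y n)" for n
    using norming_functional[of "y n"] by blast
  then obtain f :: "nat \<Rightarrow> 'a \<Rightarrow>\<^sub>L real" where f: "\<And>n x. \<bar>blinfun_apply (f n) x\<bar> \<le> norm x" "\<And>n. blinfun_apply (f n) (y n) = norm (y n)"
    by metis
  define g where "g n = (1 / 2) ^ n *\<^sub>R f n" for n
  have "(\<lambda>n. blinfun_apply (g n) (y n)) \<longlonglongrightarrow> 0"
  proof (rule weakly_compact_diagonal_null[OF A y(1)])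
    fix N x
    have geom: "(\<Sum>n<N. (1 / 2 :: real) ^ n) \<le> 2"
      using suminf_geometric[of "1/2::real"] sum_le_suminf[OF summable_geometric[of "1/2::real"], of "{..<N}"] by auto
    have "(\<Sum>n<N. \<bar>blinfun_apply (g n) x\<bar>) \<le> (\<Sum>n<N. (1 / 2) ^ n * norm x)"
      using f(1)[of _ x] by (intro sum_mono) (simp add: g_def blinfun.scaleR_left abs_mult)
    also have "\<dots> \<le> 2 * norm x"
      unfolding sum_distrib_right[symmetric] using geom by (intro mult_right_mono) auto
    finally show "(\<Sum>n<N. \<bar>blinfun_apply (g n) x\<bar>) \<le> 2 * norm x" .
  qed
  moreover have "1 \<le> blinfun_apply (g n) (y n)" for n
    using y(2)[of n] by (simp add: g_def blinfun.scaleR_left f(2) power_divide field_simps)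
  ultimately have "(1::real) \<le> 0" by (intro LIMSEQ_le_const) auto
  then show False by simp
qed

section \<open>Disjoint sequences in solid hulls\<close>

lemma scaleR_inf_distrib:
  fixes x y :: "'a::banach_lattice"
  assumes "a \<ge> 0"
  shows "a *\<^sub>R inf x y = inf (a *\<^sub>R x) (a *\<^sub>R y)"
proof (cases "a = 0")
  case False
  then have a: "a > 0" using assms by simp
  let ?m = "inf (a *\<^sub>R x) (a *\<^sub>R y)"
  have "inverse a *\<^sub>R ?m \<le> inverse a *\<^sub>R a *\<^sub>R x" "inverse a *\<^sub>R ?m \<le> inverse a *\<^sub>R a *\<^sub>R y"
    using a by (intro scaleR_left_mono; simp)+
  then have "inverse a *\<^sub>R ?m \<le> inf x y" using a by simp
  then have "a *\<^sub>R inverse a *\<^sub>R ?m \<le> a *\<^sub>R inf x y"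
    using a by (intro scaleR_left_mono) auto
  then have "?m \<le> a *\<^sub>R inf x y" using a by simp
  moreover have "a *\<^sub>R inf x y \<le> ?m"
    using a by (intro inf_greatest scaleR_left_mono) auto
  ultimately show ?thesis by (rule antisym[rotated])
qed simp

lemma scaleR_pprt:
  fixes x :: "'a::banach_lattice"
  assumes "a \<ge> 0"
  shows "a *\<^sub>R pprt x = pprt (a *\<^sub>R x)"
  using scaleR_inf_distrib[OF assms, of "- x" 0]
  unfolding pprt_def sup_eq_neg_inf[of _ 0] minus_zero scaleR_minus_right
  by (simp only: scaleR_zero_right)

lemma pprt_add_le: "pprt (x + y) \<le> pprt x + pprt (y::'a::lattice_ab_group_add)"
proof -
  have "x + y \<le> pprt x + pprt y" "0 \<le> pprt x + pprt y"
    by (auto simp: pprt_def intro!: add_mono)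
  then show ?thesis unfolding pprt_def[of "x + y"] by (rule le_supI)
qed

lemma pprt_le_abs: "pprt x \<le> \<bar>x::'a::lattice_ab_group_add_abs\<bar>"
  by (simp add: abs_prts)

lemma abs_pprt_pprt: "\<bar>x\<bar> = pprt x + pprt (- x::'a::lattice_ab_group_add_abs)"
  by (simp add: abs_prts pprt_neg)

text \<open>By distributivity the right-hand side is an infimum of four sums, one equal to
  \<open>a + b\<close> and the other three above \<open>c\<close>.\<close>

lemma inf_add_le:
  fixes a b c :: "'a::lattice_ab_group_add"
  assumes "0 \<le> a" "0 \<le> b" "0 \<le> c"
  shows "inf (a + b) c \<le> inf a c + inf b c"
proof -
  have "inf a c + inf b c = inf (inf (a + b) (a + c)) (inf (c + b) (c + c))"
    by (simp add: add_inf_distrib_left add_inf_distrib_right inf_assoc inf_left_commute inf_commute)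
  moreover have "c \<le> a + c" "c \<le> c + b" "c \<le> c + c" using assms by auto
  ultimately show ?thesis by (simp add: le_infI2)
qed

text \<open>Since \<open>pprt x = x + pprt (- x)\<close>, translation reduces the infimum to
  \<open>inf x 0 + pprt (- x)\<close>, whose terms cancel.\<close>

lemma inf_pprt_uminus: "inf (pprt x) (pprt (- x)) = (0::'a::lattice_ab_group_add)"
proof -
  have "pprt x = x + pprt (- x)"
    using prts[of x] by (simp add: pprt_neg algebra_simps)
  then have "inf (pprt x) (pprt (- x)) = inf x 0 + pprt (- x)"
    by (metis add_0 add_inf_distrib_right)
  then show ?thesis by (simp add: pprt_neg flip: nprt_def)
qed

text \<open>A sum of two elements is the sum of their infimum and supremum, so for disjoint ones it
  is the supremum. By \<open>inf_add_le\<close> each partial sum stays disjoint from the later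
  terms, and the induction goes through.\<close>

lemma sum_disjoint_le:
  fixes u :: "nat \<Rightarrow> 'a::lattice_ab_group_add"
  assumes "\<And>n. 0 \<le> u n" "\<And>n m. n \<noteq> m \<Longrightarrow> inf (u n) (u m) = 0" "\<And>n. u n \<le> z" "0 \<le> z"
  shows "(\<Sum>n<N. u n) \<le> z"
proof -
  have disj: "inf (\<Sum>n<N. u n) (u m) = 0" if "N \<le> m" for N m
    using that
  proof (induction N)
    case 0
    then show ?case using assms(1) by (simp add: inf_absorb1)
  next
    case (Suc N)
    have "inf (\<Sum>n<Suc N. u n) (u m) \<le> inf (\<Sum>n<N. u n) (u m) + inf (u N) (u m)"
      using assms(1) by (simp add: inf_add_le sum_nonneg)
    also have "\<dots> = 0" using Suc assms(2) by simp
    finally show ?case using assms(1) by (intro antisym) (auto intro!: sum_nonneg add_nonneg_nonneg)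
  qed
  show ?thesis
  proof (induction N)
    case (Suc N)
    have "(\<Sum>n<Suc N. u n) = sup (\<Sum>n<N. u n) (u N)"
      using disj[of N N] add_eq_inf_sup[of "\<Sum>n<N. u n" "u N"] by simp
    then show ?case using Suc assms(3) by simp
  qed (use assms(4) in simp)
qed

lemma inf_scaleR_disjoint:
  fixes u v :: "'a::banach_lattice"
  assumes "0 \<le> u" "0 \<le> v" "inf u v = 0" "0 \<le> s" "0 \<le> t"
  shows "inf (s *\<^sub>R u) (t *\<^sub>R v) = 0"
proof (rule antisym)
  have "inf (s *\<^sub>R u) (t *\<^sub>R v) \<le> inf (max s t *\<^sub>R u) (max s t *\<^sub>R v)"
    using assms by (intro inf_mono scaleR_right_mono) auto
  also have "\<dots> = 0"
    using assms scaleR_inf_distrib[of "max s t" u v] by simp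
  finally show "inf (s *\<^sub>R u) (t *\<^sub>R v) \<le> 0" .
  show "0 \<le> inf (s *\<^sub>R u) (t *\<^sub>R v)"
    using assms by (simp add: scaleR_nonneg_nonneg)
qed

section \<open>Positive functionals, moduli and band components\<close>

lemma dual_le_zeroD: "dual_le 0 f \<Longrightarrow> 0 \<le> x \<Longrightarrow> 0 \<le> blinfun_apply f x"
  by (simp add: dual_le_def)

lemma dual_nonneg_mono:
  assumes "dual_le 0 f" "x \<le> y"
  shows "blinfun_apply f x \<le> blinfun_apply f y"
  using dual_le_zeroD[OF assms(1), of "y - x"] assms(2) by (simp add: blinfun.diff_right)

lemma dual_abs_nonneg: "dual_le 0 (dual_abs f)"
  unfolding dual_le_def
proof (intro allI impI)
  fix x :: 'a assume "0 \<le> x"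
  then have "blinfun_apply f x \<le> blinfun_apply (dual_abs f) x" "blinfun_apply (- f) x \<le> blinfun_apply (dual_abs f) x"
    using dual_sup_lub(1,2)[where f=f and g="- f"] by (simp_all add: dual_le_def dual_abs_def)
  then show "blinfun_apply 0 x \<le> blinfun_apply (dual_abs f) x"
    by (simp add: uminus_blinfun.rep_eq)
qed

lemma dual_abs_upper:
  assumes "\<bar>u\<bar> \<le> x"
  shows "\<bar>blinfun_apply f u\<bar> \<le> blinfun_apply (dual_abs f) x"
proof -
  have *: "\<bar>blinfun_apply f v\<bar> \<le> blinfun_apply (dual_abs f) v" if "0 \<le> v" for v
    using that dual_sup_lub(1,2)[where f=f and g="- f"]
    by (auto simp add: dual_le_def dual_abs_def uminus_blinfun.rep_eq abs_le_iff)
  have "u = pprt u - pprt (- u)" using prts[of u] by (simp add: pprt_neg)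
  then have "blinfun_apply f u = blinfun_apply f (pprt u) - blinfun_apply f (pprt (- u))"
    by (metis blinfun.diff_right)
  then have "\<bar>blinfun_apply f u\<bar> \<le> \<bar>blinfun_apply f (pprt u)\<bar> + \<bar>blinfun_apply f (pprt (- u))\<bar>"
    by simp
  also have "\<dots> \<le> blinfun_apply (dual_abs f) (pprt u) + blinfun_apply (dual_abs f) (pprt (- u))"
    using *[of "pprt u"] *[of "pprt (- u)"] by simp
  also have "\<dots> = blinfun_apply (dual_abs f) \<bar>u\<bar>"
    by (simp add: abs_pprt_pprt blinfun.add_right)
  also have "\<dots> \<le> blinfun_apply (dual_abs f) x"
    by (rule dual_nonneg_mono[OF dual_abs_nonneg assms])
  finally show ?thesis .
qed

text \<open>The substitution \<open>u = y + y - x\<close> takes \<open>{0..x}\<close> into the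
  elements with \<open>\<bar>u\<bar> \<le> x\<close> and turns each term of the Riesz--Kantorovich
  formula for the modulus into a value of \<open>f\<close>.\<close>

lemma dual_abs_least:
  assumes "0 \<le> x" and "\<And>u. \<bar>u\<bar> \<le> x \<Longrightarrow> blinfun_apply f u \<le> c"
  shows "blinfun_apply (dual_abs f) x \<le> c"
  unfolding dual_abs_def dual_sup_apply[OF assms(1)]
proof (rule cSUP_least)
  fix y assume y: "y \<in> {0..x}"
  have "y + y - x \<le> x" "- (y + y - x) \<le> x"
    using y add_mono[of y x y x] by (auto simp: diff_le_eq)
  then have "blinfun_apply f (y + y - x) \<le> c"
    by (intro assms(2)) (simp add: abs_le_iff)
  then show "blinfun_apply f y + blinfun_apply (- f) (x - y) \<le> c"
    by (simp add: blinfun.add_right blinfun.diff_right uminus_blinfun.rep_eq)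
qed (use assms(1) in auto)

text \<open>The component of the positive functional \<open>f\<close> on the principal band generated by \<open>u\<close>,
  made sublinear by composition with the positive part.\<close>

definition band_functional :: "('a::banach_lattice \<Rightarrow>\<^sub>L real) \<Rightarrow> 'a \<Rightarrow> 'a \<Rightarrow> real" where
  "band_functional f u x = (SUP k. blinfun_apply f (inf (pprt x) (real k *\<^sub>R u)))"

text \<open>The truncations increase with \<open>k\<close> and stay below \<open>pprt x\<close>, so
  the supremum is a limit and inequalities can be transferred from each fixed
  \<open>k\<close>.\<close>

lemma band_functional:
  assumes f: "dual_le 0 f" and u: "0 \<le> u"
  shows band_functional_tendsto:
      "(\<lambda>k. blinfun_apply f (inf (pprt x) (real k *\<^sub>R u))) \<longlonglongrightarrow> band_functional f u x"
    and band_functional_upper: "blinfun_apply f (inf (pprt x) (real k *\<^sub>R u)) \<le> band_functional f u x"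
    and band_functional_le: "band_functional f u x \<le> blinfun_apply f (pprt x)"
proof -
  have le: "blinfun_apply f (inf (pprt x) (real k *\<^sub>R u)) \<le> blinfun_apply f (pprt x)" for k
    by (intro dual_nonneg_mono[OF f]) simp
  then have bdd: "bdd_above (range (\<lambda>k. blinfun_apply f (inf (pprt x) (real k *\<^sub>R u))))"
    by (intro bdd_aboveI) auto
  have "incseq (\<lambda>k. blinfun_apply f (inf (pprt x) (real k *\<^sub>R u)))"
    by (intro incseq_SucI dual_nonneg_mono[OF f] inf_mono order_refl scaleR_right_mono u) simp
  then show "(\<lambda>k. blinfun_apply f (inf (pprt x) (real k *\<^sub>R u))) \<longlonglongrightarrow> band_functional f u x"
    unfolding band_functional_def using bdd by (intro LIMSEQ_incseq_SUP)
  show "blinfun_apply f (inf (pprt x) (real k *\<^sub>R u)) \<le> band_functional f u x"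
    unfolding band_functional_def using bdd by (intro cSUP_upper) auto
  show "band_functional f u x \<le> blinfun_apply f (pprt x)"
    unfolding band_functional_def using le by (intro cSUP_least) auto
qed

text \<open>Subadditivity holds for each \<open>k\<close> and survives the limit. A positive scalar
  is absorbed by a larger multiple of \<open>u\<close>, which the supremum over \<open>k\<close>
  already contains.\<close>

lemma sublinear_band_functional:
  assumes f: "dual_le 0 f" and u: "0 \<le> u"
  shows "sublinear (band_functional f u)"
  unfolding sublinear_def
proof (intro conjI allI impI)
  fix x y
  have "blinfun_apply f (inf (pprt (x + y)) (real k *\<^sub>R u)) \<le>
      blinfun_apply f (inf (pprt x) (real k *\<^sub>R u)) + blinfun_apply f (inf (pprt y) (real k *\<^sub>R u))" for k
  proof -
    have "inf (pprt (x + y)) (real k *\<^sub>R u) \<le> inf (pprt x + pprt y) (real k *\<^sub>R u)"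
      by (intro inf_mono pprt_add_le order_refl)
    also have "\<dots> \<le> inf (pprt x) (real k *\<^sub>R u) + inf (pprt y) (real k *\<^sub>R u)"
      by (intro inf_add_le) (auto simp: scaleR_nonneg_nonneg u)
    finally show ?thesis
      using dual_nonneg_mono[OF f] by (metis blinfun.add_right)
  qed
  then show "band_functional f u (x + y) \<le> band_functional f u x + band_functional f u y"
    by (intro LIMSEQ_le[OF band_functional_tendsto[OF f u]
          tendsto_add[OF band_functional_tendsto[OF f u] band_functional_tendsto[OF f u]]]) blast
next
  fix a :: real and x
  assume a: "0 \<le> a"
  show "band_functional f u (a *\<^sub>R x) \<le> a * band_functional f u x"
  proof (cases "a = 0")
    case True
    then show ?thesis using band_functional_le[OF f u, of 0] by (simp add: blinfun.zero_right)
  next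
    case False
    then have a: "a > 0" using a by simp
    have "blinfun_apply f (inf (pprt (a *\<^sub>R x)) (real k *\<^sub>R u)) \<le> a * band_functional f u x" for k
    proof -
      obtain m where m: "real k / a \<le> real m" using real_arch_simple by blast
      have "real k *\<^sub>R u \<le> (a * real m) *\<^sub>R u"
        using m a u by (intro scaleR_right_mono) (auto simp: field_simps)
      then have "inf (pprt (a *\<^sub>R x)) (real k *\<^sub>R u) \<le> a *\<^sub>R inf (pprt x) (real m *\<^sub>R u)"
        using a by (simp add: scaleR_inf_distrib scaleR_pprt le_infI2)
      then have "blinfun_apply f (inf (pprt (a *\<^sub>R x)) (real k *\<^sub>R u))
          \<le> a * blinfun_apply f (inf (pprt x) (real m *\<^sub>R u))"
        using dual_nonneg_mono[OF f] by (metis blinfun.scaleR_right real_scaleR_def)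
      also have "\<dots> \<le> a * band_functional f u x"
        using a band_functional_upper[OF f u] by simp
      finally show ?thesis .
    qed
    then show ?thesis
      unfolding band_functional_def[of f u "a *\<^sub>R x"] by (intro cSUP_least) auto
  qed
qed

text \<open>For fixed \<open>k\<close> the truncations of \<open>pprt x\<close> by the disjoint
  \<open>real k *\<^sub>R u n\<close> are disjoint in \<open>n\<close>, so their sum stays below
  \<open>pprt x\<close>. This is the source of the summability bound needed for the Schur
  argument.\<close>

lemma sum_band_functional_le:
  fixes u :: "nat \<Rightarrow> 'a::banach_lattice"
  assumes f: "dual_le 0 f" and u: "\<And>n. 0 \<le> u n" "\<And>n m. n \<noteq> m \<Longrightarrow> inf (u n) (u m) = 0"
  shows "(\<Sum>n<N. band_functional f (u n) x) \<le> blinfun_apply f (pprt x)"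
proof (rule LIMSEQ_le_const2)
  show "(\<lambda>k. \<Sum>n<N. blinfun_apply f (inf (pprt x) (real k *\<^sub>R u n)))
      \<longlonglongrightarrow> (\<Sum>n<N. band_functional f (u n) x)"
    by (intro tendsto_sum band_functional_tendsto f u)
  have "(\<Sum>n<N. inf (pprt x) (real k *\<^sub>R u n)) \<le> pprt x" for k
  proof (rule sum_disjoint_le)
    fix n m :: nat assume "n \<noteq> m"
    then have "inf (real k *\<^sub>R u n) (real k *\<^sub>R u m) = 0"
      using u by (intro inf_scaleR_disjoint) auto
    then have "inf (inf (pprt x) (real k *\<^sub>R u n)) (inf (pprt x) (real k *\<^sub>R u m)) \<le> 0"
      by (metis inf_mono inf_le2)
    then show "inf (inf (pprt x) (real k *\<^sub>R u n)) (inf (pprt x) (real k *\<^sub>R u m)) = 0"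
      by (intro antisym) (auto simp: scaleR_nonneg_nonneg u)
  qed (auto simp: scaleR_nonneg_nonneg u)
  then have "(\<Sum>n<N. blinfun_apply f (inf (pprt x) (real k *\<^sub>R u n))) \<le> blinfun_apply f (pprt x)" for k
    using dual_nonneg_mono[OF f] by (metis blinfun.sum_right)
  then show "\<exists>M. \<forall>k\<ge>M. (\<Sum>n<N. blinfun_apply f (inf (pprt x) (real k *\<^sub>R u n))) \<le> blinfun_apply f (pprt x)"
    by blast
qed

lemma norm_pprt_le: "norm (pprt x) \<le> norm (x::'a::banach_lattice)"
  by (intro norm_le_if_abs_le) (simp add: pprt_le_abs)

text \<open>Hahn--Banach gives functionals \<open>g n\<close> below the band components that agree
  with them at \<open>c *\<^sub>R y n\<close>. They are absolutely summable at every point, so their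
  diagonal values vanish in the limit and dominate \<open>f (u n)\<close>. The factor
  \<open>c\<close> allows both \<open>y n\<close> and \<open>- y n\<close> to be treated with points
  of \<open>A\<close> itself.\<close>

lemma disjoint_below_weakly_compact_null:
  fixes A :: "'a::banach_lattice set"
  assumes A: "relatively_weakly_compact A" and y: "\<And>n. y n \<in> A" and f: "dual_le 0 f"
    and u: "\<And>n. 0 \<le> u n" "\<And>n m. n \<noteq> m \<Longrightarrow> inf (u n) (u m) = 0"
    and uy: "\<And>n. u n \<le> pprt (c *\<^sub>R y n)"
  shows "(\<lambda>n. blinfun_apply f (u n)) \<longlonglongrightarrow> 0"
proof -
  have "\<exists>g :: 'a \<Rightarrow>\<^sub>L real. (\<forall>x. blinfun_apply g x \<le> band_functional f (u n) x) \<and>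
      blinfun_apply g (c *\<^sub>R y n) = band_functional f (u n) (c *\<^sub>R y n)" for n
  proof -
    have "band_functional f (u n) x \<le> norm f * norm x" for x
    proof -
      have "band_functional f (u n) x \<le> norm (blinfun_apply f (pprt x))"
        using band_functional_le[OF f u(1), of n x] by simp
      also have "\<dots> \<le> norm f * norm x"
        by (intro order_trans[OF norm_blinfun] mult_left_mono norm_pprt_le) simp
      finally show ?thesis .
    qed
    then show ?thesis
      using hahn_banach_sublinear[OF sublinear_band_functional[OF f u(1)], of n "norm f" "c *\<^sub>R y n"]
      by blast
  qed
  then obtain g :: "nat \<Rightarrow> 'a \<Rightarrow>\<^sub>L real"
    where g: "\<And>n x. blinfun_apply (g n) x \<le> band_functional f (u n) x"
      "\<And>n. blinfun_apply (g n) (c *\<^sub>R y n) = band_functional f (u n) (c *\<^sub>R y n)"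
    by metis
  have "(\<lambda>n. blinfun_apply (g n) (y n)) \<longlonglongrightarrow> 0"
  proof (rule weakly_compact_diagonal_null[OF A y])
    fix N x
    have nonneg: "0 \<le> band_functional f (u n) x" for n x
      using band_functional_upper[OF f u(1), of x 0 n] by (simp add: inf_absorb2)
    have "\<bar>blinfun_apply (g n) x\<bar> \<le> band_functional f (u n) x + band_functional f (u n) (- x)" for n
      using g(1)[of n x] g(1)[of n "- x"] nonneg[of n x] nonneg[of n "- x"] by (simp add: blinfun.minus_right)
    then have "(\<Sum>n<N. \<bar>blinfun_apply (g n) x\<bar>)
        \<le> (\<Sum>n<N. band_functional f (u n) x) + (\<Sum>n<N. band_functional f (u n) (- x))"
      by (simp add: sum_mono flip: sum.distrib)
    also have "\<dots> \<le> blinfun_apply f (pprt x) + blinfun_apply f (pprt (- x))"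
      by (intro add_mono sum_band_functional_le f u)
    also have "\<dots> = blinfun_apply f \<bar>x\<bar>" by (simp add: abs_pprt_pprt blinfun.add_right)
    also have "\<dots> \<le> norm f * norm \<bar>x\<bar>" using norm_blinfun[of f "\<bar>x\<bar>"] by simp
    also have "\<dots> \<le> norm f * norm x" by (intro mult_left_mono norm_le_if_abs_le) auto
    finally show "(\<Sum>n<N. \<bar>blinfun_apply (g n) x\<bar>) \<le> norm f * norm x" .
  qed
  then have lim: "(\<lambda>n. c * blinfun_apply (g n) (y n)) \<longlonglongrightarrow> 0" by (rule tendsto_mult_right_zero)
  have "0 \<le> blinfun_apply f (u n)" for n using dual_le_zeroD[OF f u(1)] .
  \<comment> \<open>At \<open>k = 1\<close> the truncation of \<open>pprt (c *\<^sub>R y n)\<close>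
    by \<open>u n\<close> is \<open>u n\<close> itself.\<close>
  moreover have "blinfun_apply f (u n) \<le> c * blinfun_apply (g n) (y n)" for n
    using band_functional_upper[OF f u(1), of "c *\<^sub>R y n" 1 n] g(2)[of n] uy[of n]
    by (simp add: inf_absorb2 blinfun.scaleR_right)
  ultimately show ?thesis
    by (intro Lim_null_comparison[OF _ lim] always_eventually) simp
qed

text \<open>From \<open>u n \<le> \<bar>y n\<bar>\<close> each \<open>u n\<close> is dominated by
  the sum of its infima with the positive parts of \<open>y n\<close> and \<open>- y n\<close>. Both
  families of infima inherit disjointness from \<open>u\<close>, so the preceding lemma applies with
  \<open>c\<close> equal to \<open>1\<close> and \<open>- 1\<close>.\<close>

lemma disjoint_solid_hull_weakly_null:
  assumes A: "relatively_weakly_compact A" and u: "disjoint_seq u" "\<And>n. 0 \<le> u n" "\<And>n. u n \<in> solid_hull A"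
  shows "weakly_null u"
  unfolding weakly_null_iff
proof
  fix f
  have "\<exists>y. y \<in> A \<and> u n \<le> \<bar>y\<bar>" for n
    using u(3)[of n] unfolding solid_hull_def mem_Collect_eq abs_of_nonneg[OF u(2)] by blast
  then obtain y where y: "\<And>n. y n \<in> A" "\<And>n. u n \<le> \<bar>y n\<bar>" by metis
  have disj: "inf (u n) (u m) = 0" if "n \<noteq> m" for n m
    using u(1,2) that by (simp add: disjoint_seq_def abs_of_nonneg)
  have null: "(\<lambda>n. blinfun_apply (dual_abs f) (inf (u n) (pprt (c *\<^sub>R y n)))) \<longlonglongrightarrow> 0" for c
  proof (rule disjoint_below_weakly_compact_null[OF A y(1) dual_abs_nonneg])
    show nonneg: "0 \<le> inf (u n) (pprt (c *\<^sub>R y n))" for n using u(2) by simp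
    show "inf (inf (u n) (pprt (c *\<^sub>R y n))) (inf (u m) (pprt (c *\<^sub>R y m))) = 0" if "n \<noteq> m" for n m
    proof (rule antisym)
      show "inf (inf (u n) (pprt (c *\<^sub>R y n))) (inf (u m) (pprt (c *\<^sub>R y m))) \<le> 0"
        using disj[OF that] by (metis inf_mono inf_le1)
    qed (use nonneg in auto)
    show "inf (u n) (pprt (c *\<^sub>R y n)) \<le> pprt (c *\<^sub>R y n)" for n by simp
  qed
  have "\<bar>blinfun_apply f (u n)\<bar> \<le> blinfun_apply (dual_abs f) (inf (u n) (pprt (1 *\<^sub>R y n))) +
      blinfun_apply (dual_abs f) (inf (u n) (pprt ((- 1) *\<^sub>R y n)))" for n
  proof -
    have "u n = inf (pprt (y n) + pprt (- y n)) (u n)"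
      using y(2)[of n] by (simp add: abs_pprt_pprt inf_absorb2)
    also have "\<dots> \<le> inf (pprt (y n)) (u n) + inf (pprt (- y n)) (u n)"
      by (intro inf_add_le) (auto simp: u(2))
    finally have "blinfun_apply (dual_abs f) (u n)
        \<le> blinfun_apply (dual_abs f) (inf (u n) (pprt (1 *\<^sub>R y n)) + inf (u n) (pprt ((- 1) *\<^sub>R y n)))"
      by (intro dual_nonneg_mono[OF dual_abs_nonneg]) (simp add: inf_commute)
    then show ?thesis
      using dual_abs_upper[of "u n" "u n" f] u(2) by (simp add: blinfun.add_right abs_of_nonneg)
  qed
  moreover have lim: "(\<lambda>n. blinfun_apply (dual_abs f) (inf (u n) (pprt (1 *\<^sub>R y n))) +
      blinfun_apply (dual_abs f) (inf (u n) (pprt ((- 1) *\<^sub>R y n)))) \<longlonglongrightarrow> 0"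
    using tendsto_add[OF null[of 1] null[of "- 1"]] by simp
  ultimately show "(\<lambda>n. blinfun_apply f (u n)) \<longlonglongrightarrow> 0"
    by (intro Lim_null_comparison[OF _ lim] always_eventually) simp
qed

section \<open>Disjoint sequences extracted from positive ones\<close>

lemma banach_lattice_limit_nonneg:
  fixes x :: "nat \<Rightarrow> 'a::banach_lattice"
  assumes lim: "x \<longlonglongrightarrow> l" and nonneg: "\<And>n. 0 \<le> x n"
  shows "0 \<le> l"
proof -
  \<comment> \<open>As \<open>x n\<close> is positive, the negative part of the limit lies below
    \<open>pprt (x n - l)\<close>, which is small in norm.\<close>
  have "norm (pprt (- l)) \<le> norm (x n - l)" for n
  proof (rule norm_le_if_abs_le)
    have "pprt (- l) \<le> pprt (x n - l)" using nonneg[of n] by (intro pprt_mono) simp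
    then show "\<bar>pprt (- l)\<bar> \<le> \<bar>x n - l\<bar>"
      using pprt_le_abs[of "x n - l"] by (simp add: abs_of_nonneg)
  qed
  moreover have "(\<lambda>n. norm (x n - l)) \<longlonglongrightarrow> 0"
    using tendsto_norm_zero[OF LIM_zero[OF lim]] .
  ultimately have "norm (pprt (- l)) \<le> 0"
    by (intro LIMSEQ_le_const) auto
  then show ?thesis using le_zero_iff_zero_pprt[of "- l"] by simp
qed

lemma le_suminf_banach_lattice:
  fixes v :: "nat \<Rightarrow> 'a::banach_lattice"
  assumes v: "summable v" "\<And>n. 0 \<le> v n"
  shows "v i \<le> suminf v"
proof -
  \<comment> \<open>The shift by \<open>Suc i\<close> ensures that the \<open>i\<close>-th term
    occurs in every partial sum.\<close>
  have "(\<lambda>n. (\<Sum>k<n + Suc i. v k) - v i) \<longlonglongrightarrow> suminf v - v i"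
    by (intro tendsto_diff tendsto_const LIMSEQ_ignore_initial_segment summable_LIMSEQ v)
  moreover have "v i \<le> (\<Sum>k<n + Suc i. v k)" for n
    using sum_mono2[of "{..<n + Suc i}" "{i}" v] v(2) by simp
  then have "0 \<le> (\<Sum>k<n + Suc i. v k) - v i" for n
    by simp
  ultimately have "0 \<le> suminf v - v i" by (rule banach_lattice_limit_nonneg)
  then show ?thesis by simp
qed

text \<open>For \<open>k < m\<close>, the \<open>m\<close>-th term is dominated by \<open>d\<^sup>+\<close> and \<open>4\<^sup>m\<close> times the \<open>k\<close>-th one by \<open>d\<^sup>-\<close>,
  where \<open>d = v\<^sub>m\<^sub>+\<^sub>1 - 4\<^sup>m v\<^sub>k\<^sub>+\<^sub>1\<close>.\<close>

lemma disjoint_seq_pprt_diff: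
  fixes v w :: "nat \<Rightarrow> 'a::banach_lattice"
  assumes v: "\<And>n. 0 \<le> v n" and w: "\<And>i k. i \<le> k \<Longrightarrow> v i \<le> w k"
    and z: "\<And>i. (1 / 2) ^ i *\<^sub>R v i \<le> z"
  shows "disjoint_seq (\<lambda>k. pprt (v (Suc k) - 4 ^ k *\<^sub>R w k - (1 / 2) ^ k *\<^sub>R z))"
proof -
  define u where "u k = pprt (v (Suc k) - 4 ^ k *\<^sub>R w k - (1 / 2) ^ k *\<^sub>R z)" for k
  have u0: "0 \<le> u k" for k by (simp add: u_def)
  have w0: "0 \<le> w k" for k using v w order_trans by blast
  have z0: "0 \<le> z" using z[of 0] v[of 0] by simp
  have disj: "inf (u k) (u m) = 0" if km: "k < m" for k m
  proof -
    define d where "d = v (Suc m) - 4 ^ m *\<^sub>R v (Suc k)"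
    have 1: "u m \<le> pprt d"
      unfolding u_def d_def
    proof (rule pprt_mono)
      have "4 ^ m *\<^sub>R v (Suc k) \<le> (4 :: real) ^ m *\<^sub>R w m"
        using km w by (intro scaleR_left_mono) auto
      moreover have "0 \<le> ((1 / 2) ^ m :: real) *\<^sub>R z" using z0 by (simp add: scaleR_nonneg_nonneg)
      ultimately show "v (Suc m) - 4 ^ m *\<^sub>R w m - (1 / 2) ^ m *\<^sub>R z \<le> v (Suc m) - 4 ^ m *\<^sub>R v (Suc k)"
        by (meson diff_left_mono diff_le_eq le_add_same_cancel1 order_trans)
    qed
    \<comment> \<open>Since \<open>k + m + 1 \<le> 2 * m\<close>, the factor \<open>4 ^ m\<close>
      outweighs all the halvings; hence \<open>4 ^ m *\<^sub>R (1 / 2) ^ k *\<^sub>R z\<close>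
      dominates \<open>v (Suc m)\<close>.\<close>
    have coef: "1 \<le> 4 ^ m * ((1 / 2) ^ k * (1 / 2) ^ Suc m :: real)"
    proof -
      have "2 ^ k * 2 ^ Suc m = (2 :: real) ^ (Suc k + m)" by (simp add: power_add)
      also have "\<dots> \<le> 2 ^ (m + m)" using km by (intro power_increasing) auto
      also have "\<dots> = 4 ^ m" by (simp add: power_add flip: power_mult_distrib)
      finally show ?thesis by (simp add: power_divide field_simps)
    qed
    have "4 ^ m *\<^sub>R u k = pprt (4 ^ m *\<^sub>R (v (Suc k) - 4 ^ k *\<^sub>R w k - (1 / 2) ^ k *\<^sub>R z))"
      unfolding u_def by (rule scaleR_pprt) simp
    also have "\<dots> \<le> pprt (- d)"
    proof (rule pprt_mono)
      have "v (Suc m) \<le> (4 ^ m * ((1 / 2) ^ k * (1 / 2) ^ Suc m)) *\<^sub>R v (Suc m)"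
        using scaleR_right_mono[OF coef v[of "Suc m"]] by simp
      also have "\<dots> = 4 ^ m *\<^sub>R (1 / 2) ^ k *\<^sub>R (1 / 2) ^ Suc m *\<^sub>R v (Suc m)" by simp
      also have "\<dots> \<le> 4 ^ m *\<^sub>R (1 / 2) ^ k *\<^sub>R z"
        by (intro scaleR_left_mono z) auto
      finally have "v (Suc m) \<le> 4 ^ m *\<^sub>R (1 / 2) ^ k *\<^sub>R z" .
      moreover have "0 \<le> (4 :: real) ^ m *\<^sub>R (4 :: real) ^ k *\<^sub>R w k"
        using w0 by (intro scaleR_nonneg_nonneg) auto
      ultimately have "v (Suc m) + 0 \<le> 4 ^ m *\<^sub>R (1 / 2) ^ k *\<^sub>R z + (4 :: real) ^ m *\<^sub>R (4 :: real) ^ k *\<^sub>R w k"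
        by (rule add_mono)
      then have "4 ^ m *\<^sub>R v (Suc k) - (4 ^ m *\<^sub>R (1 / 2) ^ k *\<^sub>R z + (4 :: real) ^ m *\<^sub>R (4 :: real) ^ k *\<^sub>R w k)
          \<le> 4 ^ m *\<^sub>R v (Suc k) - v (Suc m)"
        by (intro diff_left_mono) simp
      then show "4 ^ m *\<^sub>R (v (Suc k) - 4 ^ k *\<^sub>R w k - (1 / 2) ^ k *\<^sub>R z) \<le> - d"
        unfolding d_def scaleR_diff_right by (simp only: diff_diff_eq minus_diff_eq add.commute)
    qed
    finally have 2: "4 ^ m *\<^sub>R u k \<le> pprt (- d)" .
    have "1 *\<^sub>R u k \<le> (4 :: real) ^ m *\<^sub>R u k"
      by (intro scaleR_right_mono u0) simp
    then have "u k \<le> pprt (- d)" using 2 by simp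
    then have "inf (u k) (u m) \<le> inf (pprt (- d)) (pprt d)" using 1 by (rule inf_mono)
    also have "\<dots> = 0" using inf_pprt_uminus[of d] by (simp add: inf_commute)
    finally show ?thesis using u0 by (intro antisym) auto
  qed
  have "inf (u k) (u m) = 0" if "k \<noteq> m" for k m
    using disj[of k m] disj[of m k] that by (cases "k < m") (auto simp: inf_commute)
  then show ?thesis
    unfolding disjoint_seq_def u_def[symmetric] by (simp add: abs_of_nonneg u0)
qed

text \<open>Along a sparse subsequence, a multiple of the earlier terms and a small multiple of a
  common majorant \<open>z\<close> are subtracted from each \<open>v (r (Suc k))\<close>. The
  positive parts of the differences are disjoint and stay in \<open>B\<close> by solidity, while the
  values of the functionals change by an amount tending to \<open>0\<close>.\<close>

lemma solid_disjoint_small: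
  fixes h :: "nat \<Rightarrow> 'a::banach_lattice \<Rightarrow>\<^sub>L real"
  assumes B: "bounded B" and solid: "\<And>x y. x \<in> B \<Longrightarrow> \<bar>y\<bar> \<le> \<bar>x\<bar> \<Longrightarrow> y \<in> B"
    and null: "weak_star_null (\<lambda>n. dual_abs (h n))"
    and disj: "\<And>r u. strict_mono (r :: nat \<Rightarrow> nat) \<Longrightarrow> disjoint_seq u \<Longrightarrow> (\<And>n. 0 \<le> u n) \<Longrightarrow>
      (\<And>n. u n \<in> B) \<Longrightarrow> (\<lambda>n. blinfun_apply (h (r n)) (u n)) \<longlonglongrightarrow> 0"
    and v: "\<And>n. v n \<in> B" "\<And>n. 0 \<le> v n" and \<epsilon>: "0 < \<epsilon>"
  shows "\<exists>n. \<bar>blinfun_apply (h n) (v n)\<bar> < \<epsilon>"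
proof (rule ccontr)
  assume "\<not> ?thesis"
  then have big: "\<epsilon> \<le> \<bar>blinfun_apply (h n) (v n)\<bar>" for n by (meson not_less)
  have lim: "(\<lambda>n. blinfun_apply (dual_abs (h n)) x) \<longlonglongrightarrow> 0" for x
    using null by (simp add: weak_star_null_iff)
  \<comment> \<open>The sum runs over all indices up to \<open>r k\<close>, so the condition on the
    next index depends only on the current one. The rate \<open>(1 / 8) ^ k\<close> still leaves
    \<open>(1 / 2) ^ k\<close> after multiplication by \<open>4 ^ k\<close>.\<close>
  have "\<exists>r. \<forall>k. True \<and> (r k < r (Suc k) \<and>
      blinfun_apply (dual_abs (h (r (Suc k)))) (\<Sum>i\<le>r k. v i) < (1 / 8) ^ k)"
  proof (rule dependent_nat_choice)
    fix a k :: nat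
    have "\<forall>\<^sub>F b in sequentially. blinfun_apply (dual_abs (h b)) (\<Sum>i\<le>a. v i) < (1 / 8) ^ k"
      by (rule order_tendstoD(2)[OF lim]) simp
    then have "\<forall>\<^sub>F b in sequentially. a < b \<and> blinfun_apply (dual_abs (h b)) (\<Sum>i\<le>a. v i) < (1 / 8) ^ k"
      using eventually_gt_at_top[of a] by eventually_elim simp
    then show "\<exists>b. True \<and> (a < b \<and> blinfun_apply (dual_abs (h b)) (\<Sum>i\<le>a. v i) < (1 / 8) ^ k)"
      using eventually_happens'[OF sequentially_bot] by blast
  qed simp
  then obtain r where r_less: "\<And>k. r k < r (Suc k)"
    and r_small: "\<And>k. blinfun_apply (dual_abs (h (r (Suc k)))) (\<Sum>i\<le>r k. v i) < (1 / 8) ^ k"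
    by metis
  have r: "strict_mono r" using r_less by (simp add: strict_mono_Suc_iff)
  define w where "w k = (\<Sum>i\<le>r k. v i)" for k
  define t where "t i = (1 / 2) ^ i *\<^sub>R v (r i)" for i
  \<comment> \<open>Boundedness of \<open>B\<close> makes this series converge in norm, and its
    positive terms all lie below the sum.\<close>
  define z where "z = suminf t"
  define u where "u k = pprt (v (r (Suc k)) - 4 ^ k *\<^sub>R w k - (1 / 2) ^ k *\<^sub>R z)" for k
  obtain M where M: "\<And>x. x \<in> B \<Longrightarrow> norm x \<le> M" using B by (auto simp: bounded_iff)
  have t0: "0 \<le> t i" for i using v(2) by (simp add: t_def scaleR_nonneg_nonneg)
  have "summable t"
  proof (rule summable_comparison_test')
    show "summable (\<lambda>i. (1 / 2) ^ i * M)" by (intro summable_mult2 summable_geometric) simp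
    show "norm (t i) \<le> (1 / 2) ^ i * M" if "i \<ge> 0" for i
      using M[OF v(1)[of "r i"]] by (simp add: t_def)
  qed
  then have tz: "t i \<le> z" for i unfolding z_def using t0 by (rule le_suminf_banach_lattice)
  have w0: "0 \<le> w k" for k unfolding w_def using v(2) by (intro sum_nonneg)
  have z0: "0 \<le> z" using t0 tz order_trans by blast
  have u_disj: "disjoint_seq u"
    unfolding u_def
  proof (rule disjoint_seq_pprt_diff[where v = "\<lambda>k. v (r k)"])
    show "v (r i) \<le> w k" if "i \<le> k" for i k
      unfolding w_def using sum_mono2[of "{..r k}" "{r i}" v] v(2) that strict_mono_less_eq[OF r] by simp
    show "(1 / 2) ^ i *\<^sub>R v (r i) \<le> z" for i using tz[of i] by (simp add: t_def)
  qed (rule v(2))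
  have b0: "0 \<le> 4 ^ k *\<^sub>R w k + (1 / 2) ^ k *\<^sub>R z" for k
    using w0 z0 by (intro add_nonneg_nonneg scaleR_nonneg_nonneg) auto
  have u_le: "u k \<le> v (r (Suc k))" for k
    unfolding u_def pprt_def diff_diff_eq
    using diff_left_mono[OF b0[of k], of "v (r (Suc k))"] v(2) by (intro le_supI) simp_all
  have uB: "u k \<in> B" for k
  proof (rule solid[OF v(1)])
    show "\<bar>u k\<bar> \<le> \<bar>v (r (Suc k))\<bar>"
      using u_le[of k] v(2) by (simp add: abs_of_nonneg u_def)
  qed
  have "strict_mono (\<lambda>k. r (Suc k))" using r_less by (simp add: strict_mono_Suc_iff)
  then have lim_u: "(\<lambda>k. blinfun_apply (h (r (Suc k))) (u k)) \<longlonglongrightarrow> 0"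
    using u_disj by (rule disj) (use uB in \<open>auto simp: u_def\<close>)
  have lim_half: "(\<lambda>k. (1 / 2 :: real) ^ k) \<longlonglongrightarrow> 0" by (intro LIMSEQ_realpow_zero) auto
  have lim_z: "(\<lambda>k. blinfun_apply (dual_abs (h (r (Suc k)))) z) \<longlonglongrightarrow> 0"
    using LIMSEQ_subseq_LIMSEQ[OF lim \<open>strict_mono (\<lambda>k. r (Suc k))\<close>] by (simp add: comp_def)
  have "\<epsilon> \<le> \<bar>blinfun_apply (h (r (Suc k))) (u k)\<bar> + (1 / 2) ^ k +
      (1 / 2) ^ k * blinfun_apply (dual_abs (h (r (Suc k)))) z" for k
  proof -
    let ?h = "h (r (Suc k))" and ?v = "v (r (Suc k))"
    have "?v - 4 ^ k *\<^sub>R w k - (1 / 2) ^ k *\<^sub>R z \<le> u k" by (simp add: u_def pprt_def)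
    then have "?v - u k \<le> 4 ^ k *\<^sub>R w k + (1 / 2) ^ k *\<^sub>R z" by (simp add: algebra_simps)
    moreover have "0 \<le> ?v - u k" using u_le by simp
    ultimately have "\<bar>blinfun_apply ?h (?v - u k)\<bar>
        \<le> blinfun_apply (dual_abs ?h) (4 ^ k *\<^sub>R w k + (1 / 2) ^ k *\<^sub>R z)"
      by (intro dual_abs_upper) (simp add: abs_of_nonneg)
    also have "\<dots> = 4 ^ k * blinfun_apply (dual_abs ?h) (w k) + (1 / 2) ^ k * blinfun_apply (dual_abs ?h) z"
      by (simp add: blinfun.add_right blinfun.scaleR_right)
    also have "4 ^ k * blinfun_apply (dual_abs ?h) (w k) \<le> 4 ^ k * (1 / 8) ^ k"
      using r_small[of k] by (intro mult_left_mono) (auto simp: w_def)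
    also have "4 ^ k * (1 / 8) ^ k = (1 / 2 :: real) ^ k"
      by (simp flip: power_mult_distrib)
    finally show ?thesis
      using big[of "r (Suc k)"] by (simp add: blinfun.diff_right)
  qed
  moreover have "(\<lambda>k. \<bar>blinfun_apply (h (r (Suc k))) (u k)\<bar> + (1 / 2) ^ k +
      (1 / 2) ^ k * blinfun_apply (dual_abs (h (r (Suc k)))) z) \<longlonglongrightarrow> 0 + 0 + 0 * 0"
    by (intro tendsto_add tendsto_mult tendsto_rabs_zero lim_u lim_half lim_z)
  ultimately have "\<epsilon> \<le> 0 + 0 + 0 * 0" by (intro LIMSEQ_le_const) auto
  then show False using \<epsilon> by simp
qed

text \<open>Failure of uniformity gives witnesses along a subsequence. Of the positive and negative
  parts of a witness, both in \<open>B\<close> by solidity, one carries at least half of the value,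
  which reduces the claim to positive witnesses.\<close>

lemma solid_disjoint_uniform:
  fixes h :: "nat \<Rightarrow> 'a::banach_lattice \<Rightarrow>\<^sub>L real"
  assumes B: "bounded B" and solid: "\<And>x y. x \<in> B \<Longrightarrow> \<bar>y\<bar> \<le> \<bar>x\<bar> \<Longrightarrow> y \<in> B"
    and null: "weak_star_null (\<lambda>n. dual_abs (h n))"
    and disj: "\<And>r u. strict_mono (r :: nat \<Rightarrow> nat) \<Longrightarrow> disjoint_seq u \<Longrightarrow> (\<And>n. 0 \<le> u n) \<Longrightarrow>
      (\<And>n. u n \<in> B) \<Longrightarrow> (\<lambda>n. blinfun_apply (h (r n)) (u n)) \<longlonglongrightarrow> 0"
    and \<epsilon>: "0 < \<epsilon>"
  shows "\<forall>\<^sub>F n in sequentially. \<forall>x\<in>B. \<bar>blinfun_apply (h n) x\<bar> \<le> \<epsilon>"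
proof (rule ccontr)
  assume "\<not> ?thesis"
  then have "\<forall>N. \<exists>n\<ge>N. \<exists>x\<in>B. \<epsilon> < \<bar>blinfun_apply (h n) x\<bar>"
    unfolding eventually_sequentially by (meson not_le)
  then have "infinite {n. \<exists>x\<in>B. \<epsilon> < \<bar>blinfun_apply (h n) x\<bar>}"
    unfolding infinite_nat_iff_unbounded_le by simp
  then obtain s :: "nat \<Rightarrow> nat" where s: "strict_mono s" "\<And>n. \<exists>x\<in>B. \<epsilon> < \<bar>blinfun_apply (h (s n)) x\<bar>"
    using infinite_enumerate[of "{n. \<exists>x\<in>B. \<epsilon> < \<bar>blinfun_apply (h n) x\<bar>}"] by auto
  have "\<exists>v\<in>B. 0 \<le> v \<and> \<epsilon> / 2 \<le> \<bar>blinfun_apply (h (s n)) v\<bar>" for n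
  proof -
    obtain x where x: "x \<in> B" "\<epsilon> < \<bar>blinfun_apply (h (s n)) x\<bar>" using s(2) by blast
    have "x = pprt x - pprt (- x)" using prts[of x] by (simp add: pprt_neg)
    then have "blinfun_apply (h (s n)) x = blinfun_apply (h (s n)) (pprt x) - blinfun_apply (h (s n)) (pprt (- x))"
      by (metis blinfun.diff_right)
    then have "\<epsilon> / 2 \<le> \<bar>blinfun_apply (h (s n)) (pprt x)\<bar> \<or> \<epsilon> / 2 \<le> \<bar>blinfun_apply (h (s n)) (pprt (- x))\<bar>"
      using x(2) by linarith
    moreover have "pprt x \<in> B" "pprt (- x) \<in> B"
      using solid[OF x(1)] pprt_le_abs[of x] pprt_le_abs[of "- x"] by (simp_all add: abs_of_nonneg)
    ultimately show ?thesis using zero_le_pprt by blast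
  qed
  then obtain v where v: "\<And>n. v n \<in> B" "\<And>n. 0 \<le> v n" "\<And>n. \<epsilon> / 2 \<le> \<bar>blinfun_apply (h (s n)) (v n)\<bar>"
    by metis
  have "\<exists>n. \<bar>blinfun_apply (h (s n)) (v n)\<bar> < \<epsilon> / 2"
  proof (rule solid_disjoint_small[OF B solid _ _ v(1,2)])
    show "weak_star_null (\<lambda>n. dual_abs (h (s n)))"
      unfolding weak_star_null_iff
    proof
      fix x
      show "(\<lambda>n. blinfun_apply (dual_abs (h (s n))) x) \<longlonglongrightarrow> 0"
        using LIMSEQ_subseq_LIMSEQ[OF _ s(1), of "\<lambda>n. blinfun_apply (dual_abs (h n)) x" 0] null
        by (simp add: comp_def weak_star_null_iff)
    qed
    fix r :: "nat \<Rightarrow> nat" and u :: "nat \<Rightarrow> 'a"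
    assume r: "strict_mono r" and u: "disjoint_seq u" "\<And>n. 0 \<le> u n" "\<And>n. u n \<in> B"
    have "strict_mono (\<lambda>n. s (r n))" using strict_mono_compose[OF s(1) r] .
    then show "(\<lambda>n. blinfun_apply (h (s (r n))) (u n)) \<longlonglongrightarrow> 0" using u by (rule disj)
  qed (use \<epsilon> in auto)
  then show False using v(3) by (meson not_less)
qed

section \<open>Sequences in the dual\<close>

lemma dual_inf_greatest: "dual_le k f \<Longrightarrow> dual_le k g \<Longrightarrow> dual_le k (dual_inf f g)"
  by (metis dual_inf_eq_neg_sup dual_le_minus_iff dual_sup_lub(3) minus_minus)

lemma dual_abs_of_nonneg:
  assumes "dual_le 0 f"
  shows "dual_abs f = f"
  unfolding dual_abs_def
proof (rule dual_sup_eqI)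
  show "dual_le (- f) f"
    using assms by (simp add: dual_le_def uminus_blinfun.rep_eq)
qed (auto intro: dual_le_refl)

lemma dual_le_abs: "dual_le f (dual_abs f)" "dual_le (- f) (dual_abs f)"
  unfolding dual_abs_def by (rule dual_sup_lub)+

text \<open>Subtracting \<open>f\<close> turns the supremum of \<open>f\<close> and \<open>0\<close>
  into that of \<open>0\<close> and \<open>- f\<close>. It lets the passage from positive
  functionals to arbitrary ones be made by linearity.\<close>

lemma dual_pos_neg_part: "f = dual_sup f 0 - dual_sup (- f) 0"
proof -
  have "dual_sup (- f) 0 = dual_sup f 0 - f"
  proof (rule dual_sup_eqI)
    show "dual_le (- f) (dual_sup f 0 - f)" "dual_le 0 (dual_sup f 0 - f)"
      using dual_sup_lub(1,2)[where f=f and g=0]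
      by (auto simp: dual_le_def uminus_blinfun.rep_eq minus_blinfun.rep_eq)
    fix k assume "dual_le (- f) k" "dual_le 0 k"
    then have "dual_le (dual_sup f 0) (k + f)"
      by (intro dual_sup_lub(3)) (auto simp: dual_le_def uminus_blinfun.rep_eq plus_blinfun.rep_eq minus_le_iff)
    then show "dual_le (dual_sup f 0 - f) k"
      by (auto simp: dual_le_def minus_blinfun.rep_eq plus_blinfun.rep_eq)
  qed
  then show ?thesis by simp
qed

lemma dual_disjoint_seq_dominated:
  assumes f: "dual_disjoint_seq f" and g: "\<And>n. dual_le 0 (g n)" "\<And>n. dual_le (g n) (dual_abs (f n))"
  shows "dual_disjoint_seq g"
  unfolding dual_disjoint_seq_def
proof (intro allI impI)
  fix n m :: nat assume "n \<noteq> m"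
  then have 0: "dual_inf (dual_abs (f n)) (dual_abs (f m)) = 0" using f by (simp add: dual_disjoint_seq_def)
  have "dual_inf (g n) (g m) = 0"
  proof (rule dual_inf_eqI)
    fix k assume "dual_le k (g n)" "dual_le k (g m)"
    then show "dual_le k 0" unfolding 0[symmetric] by (meson dual_inf_greatest dual_le_trans g(2))
  qed (rule g)+
  then show "dual_inf (dual_abs (g n)) (dual_abs (g m)) = 0" by (simp add: dual_abs_of_nonneg g(1))
qed

lemma weak_star_null_dominated:
  assumes f: "weak_star_null f" and g: "\<And>n. dual_le (dual_abs (g n)) (f n)"
  shows "weak_star_null g"
  unfolding weak_star_null_iff
proof
  fix x
  have lim: "(\<lambda>n. blinfun_apply (f n) \<bar>x\<bar>) \<longlonglongrightarrow> 0" using f by (simp add: weak_star_null_iff)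
  have "\<bar>blinfun_apply (g n) x\<bar> \<le> blinfun_apply (f n) \<bar>x\<bar>" for n
    using dual_abs_upper[of x "\<bar>x\<bar>" "g n"] g[of n] unfolding dual_le_def by (meson abs_ge_zero order_refl order_trans)
  then show "(\<lambda>n. blinfun_apply (g n) x) \<longlonglongrightarrow> 0"
    by (intro Lim_null_comparison[OF _ lim] always_eventually) simp
qed

lemma weak_star_null_subseq:
  assumes "weak_star_null f" "strict_mono r"
  shows "weak_star_null (\<lambda>n. f (r n))"
  unfolding weak_star_null_iff
proof
  fix x
  show "(\<lambda>n. blinfun_apply (f (r n)) x) \<longlonglongrightarrow> 0"
    using LIMSEQ_subseq_LIMSEQ[OF _ assms(2), of "\<lambda>n. blinfun_apply (f n) x" 0] assms(1)
    by (simp add: comp_def weak_star_null_iff)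
qed

lemma dual_disjoint_seq_subseq:
  fixes r :: "nat \<Rightarrow> nat"
  assumes "dual_disjoint_seq f" "strict_mono r"
  shows "dual_disjoint_seq (\<lambda>n. f (r n))"
  using assms by (auto simp: dual_disjoint_seq_def strict_mono_eq)

text \<open>The order interval containing the image of \<open>{- x..x}\<close> need not be
  symmetric; \<open>\<bar>c\<bar> + \<bar>d\<bar>\<close> bounds the moduli of all its
  elements.\<close>

lemma order_bounded_operatorD:
  assumes "order_bounded_operator T"
  obtains y where "0 \<le> y" "\<And>u. \<bar>u\<bar> \<le> x \<Longrightarrow> \<bar>blinfun_apply T u\<bar> \<le> y"
proof -
  obtain c d where cd: "blinfun_apply T ` {- x..x} \<subseteq> {c..d}"
    using assms unfolding order_bounded_operator_def by blast
  have "\<bar>blinfun_apply T u\<bar> \<le> \<bar>c\<bar> + \<bar>d\<bar>" if "\<bar>u\<bar> \<le> x" for u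
  proof -
    have "blinfun_apply T u \<in> {c..d}"
      using that cd by (intro subsetD[OF cd] imageI) (simp add: abs_le_iff minus_le_iff)
    then have "blinfun_apply T u \<le> \<bar>d\<bar>" "- blinfun_apply T u \<le> \<bar>c\<bar>"
      using abs_ge_self[of d] order_trans[OF le_imp_neg_le abs_ge_minus_self, of c "blinfun_apply T u"]
      by (auto intro: order_trans)
    then have "blinfun_apply T u \<le> \<bar>c\<bar> + \<bar>d\<bar>" "- blinfun_apply T u \<le> \<bar>c\<bar> + \<bar>d\<bar>"
      by (auto intro: add_increasing add_increasing2)
    then show ?thesis by (simp add: abs_le_iff)
  qed
  then show thesis using that[of "\<bar>c\<bar> + \<bar>d\<bar>"] by simp
qed

text \<open>For positive \<open>x\<close> one element \<open>y\<close> bounds all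
  \<open>\<bar>T u\<bar>\<close> with \<open>\<bar>u\<bar> \<le> x\<close>, so the modulus of the
  composition at \<open>x\<close> is at most the modulus of \<open>f n\<close> at
  \<open>y\<close>.\<close>

lemma weak_star_null_abs_compose:
  fixes T :: "'e::banach_lattice \<Rightarrow>\<^sub>L 'f::banach_lattice"
  assumes T: "order_bounded_operator T" and f: "weak_star_null (\<lambda>n. dual_abs (f n))"
  shows "weak_star_null (\<lambda>n. dual_abs (f n o\<^sub>L T))"
proof -
  have lim: "(\<lambda>n. blinfun_apply (dual_abs (f n o\<^sub>L T)) x) \<longlonglongrightarrow> 0" if x: "0 \<le> x" for x
  proof -
    obtain y where y: "0 \<le> y" "\<And>u. \<bar>u\<bar> \<le> x \<Longrightarrow> \<bar>blinfun_apply T u\<bar> \<le> y"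
      using order_bounded_operatorD[OF T] by blast
    have lim: "(\<lambda>n. blinfun_apply (dual_abs (f n)) y) \<longlonglongrightarrow> 0"
      using f by (simp add: weak_star_null_iff)
    have "blinfun_apply (dual_abs (f n o\<^sub>L T)) x \<le> blinfun_apply (dual_abs (f n)) y" for n
    proof (rule dual_abs_least[OF x])
      fix u assume "\<bar>u\<bar> \<le> x"
      then show "blinfun_apply (f n o\<^sub>L T) u \<le> blinfun_apply (dual_abs (f n)) y"
        using dual_abs_upper[OF y(2), of u "f n"] by (simp add: abs_le_iff)
    qed
    then show ?thesis
      using dual_le_zeroD[OF dual_abs_nonneg x]
      by (intro Lim_null_comparison[OF _ lim] always_eventually) simp
  qed
  show ?thesis
    unfolding weak_star_null_iff
  proof
    fix x :: 'e
    have "x = pprt x - pprt (- x)" using prts[of x] by (simp add: pprt_neg)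
    then have "blinfun_apply g x = blinfun_apply g (pprt x) - blinfun_apply g (pprt (- x))" for g :: "'e \<Rightarrow>\<^sub>L real"
      by (metis blinfun.diff_right)
    then show "(\<lambda>n. blinfun_apply (dual_abs (f n o\<^sub>L T)) x) \<longlonglongrightarrow> 0"
      using tendsto_diff[OF lim[of "pprt x"] lim[of "pprt (- x)"]] by simp
  qed
qed

section \<open>Almost limited sets\<close>

text \<open>Norming functionals make the evaluation map into the product space injective. The
  property is needed so that weakly compact sets are weakly closed.\<close>

lemma Hausdorff_weak_topology: "Hausdorff_space (weak_topology :: 'a::real_normed_vector topology)"
proof -
  define J where "J x f = blinfun_apply f x" for x :: 'a and f :: "'a \<Rightarrow>\<^sub>L real"
  have top: "topspace weak_topology = (UNIV :: 'a set)"
    by (simp add: weak_topology_def topspace_pullback_topology)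
  have "continuous_map weak_topology euclidean J"
    unfolding weak_topology_def J_def continuous_map_def
    by (auto simp: openin_pullback_topology topspace_pullback_topology)
  moreover have "inj J"
  proof (rule injI)
    fix x y assume "J x = J y"
    moreover obtain f :: "'a \<Rightarrow>\<^sub>L real" where "blinfun_apply f (x - y) = norm (x - y)"
      using norming_functional by blast
    ultimately show "x = y" by (simp add: J_def fun_eq_iff blinfun.diff_right)
  qed
  moreover have "Hausdorff_space (euclidean :: (('a \<Rightarrow>\<^sub>L real) \<Rightarrow> real) topology)"
    by (simp add: Hausdorff_space_product_topology flip: euclidean_product_topology)
  ultimately show ?thesis
    using Hausdorff_space_injective_preimage[of euclidean weak_topology J] by (simp add: top)
qed

text \<open>The range together with the limit \<open>0\<close> is weakly compact, hence weakly
  closed, and so contains the closure of the range.\<close>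

lemma weakly_null_imp_relatively_weakly_compact:
  fixes x :: "nat \<Rightarrow> 'a::real_normed_vector"
  assumes "weakly_null x"
  shows "relatively_weakly_compact (range x)"
proof -
  have c: "compactin weak_topology (insert 0 (range x))"
    using assms unfolding weakly_null_def
    by (intro compactin_sequence_with_limit) (auto simp: weak_topology_def topspace_pullback_topology)
  then have "closedin weak_topology (insert 0 (range x))"
    by (rule compactin_imp_closedin[OF Hausdorff_weak_topology])
  then have "weak_topology closure_of range x \<subseteq> insert 0 (range x)"
    by (intro closure_of_minimal) auto
  then show ?thesis
    unfolding relatively_weakly_compact_def using c by (intro closed_compactin[OF c]) auto
qed

lemma almost_limited_tendsto:
  assumes A: "almost_limited A" and f: "dual_disjoint_seq f" "weak_star_null f" and y: "\<And>n. y n \<in> A"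
  shows "(\<lambda>n. blinfun_apply (f n) (y n)) \<longlonglongrightarrow> 0"
proof -
  have "(\<lambda>n. SUP y\<in>A. ennreal \<bar>blinfun_apply (f n) y\<bar>) \<longlonglongrightarrow> 0"
    using A f by (simp add: almost_limited_def)
  then have "(\<lambda>n. ennreal \<bar>blinfun_apply (f n) (y n)\<bar>) \<longlonglongrightarrow> 0"
    by (rule tendsto_sandwich[OF _ _ tendsto_const, rotated 2]) (intro always_eventually allI SUP_upper y zero_le)+
  then have "(\<lambda>n. \<bar>blinfun_apply (f n) (y n)\<bar>) \<longlonglongrightarrow> 0"
    by (simp flip: ennreal_0)
  then show ?thesis by (rule tendsto_rabs_zero_cancel)
qed

lemma almost_limitedI:
  assumes "bounded A"
    and "\<And>f \<epsilon>. dual_disjoint_seq f \<Longrightarrow> weak_star_null f \<Longrightarrow> 0 < \<epsilon> \<Longrightarrow>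
      \<forall>\<^sub>F n in sequentially. \<forall>y\<in>A. \<bar>blinfun_apply (f n) y\<bar> \<le> \<epsilon>"
  shows "almost_limited A"
  unfolding almost_limited_def
proof (intro conjI allI impI assms(1))
  fix f :: "nat \<Rightarrow> 'a \<Rightarrow>\<^sub>L real"
  assume f: "dual_disjoint_seq f \<and> weak_star_null f"
  show "(\<lambda>n. SUP y\<in>A. ennreal \<bar>blinfun_apply (f n) y\<bar>) \<longlonglongrightarrow> 0"
  proof (rule order_tendstoI)
    fix e :: ennreal assume "0 < e"
    \<comment> \<open>An intermediate value serves two purposes: it is finite even if
      \<open>e\<close> is infinite, and it turns the weak bound on the supremum into a strict
      one.\<close>
    then obtain e' where e': "0 < e'" "e' < e" using dense by blast
    then have "e' < top" using less_le_trans top_greatest by blast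
    then obtain \<epsilon> where \<epsilon>: "0 \<le> \<epsilon>" "e' = ennreal \<epsilon>" by (cases e' rule: ennreal_cases) auto
    then have "0 < \<epsilon>" using e'(1) by simp
    then have "\<forall>\<^sub>F n in sequentially. \<forall>y\<in>A. \<bar>blinfun_apply (f n) y\<bar> \<le> \<epsilon>"
      using assms(2) f by blast
    then show "\<forall>\<^sub>F n in sequentially. (SUP y\<in>A. ennreal \<bar>blinfun_apply (f n) y\<bar>) < e"
    proof eventually_elim
      case (elim n)
      then have "(SUP y\<in>A. ennreal \<bar>blinfun_apply (f n) y\<bar>) \<le> e'"
        unfolding \<epsilon>(2) by (intro SUP_least ennreal_leI) blast
      then show ?case using e'(2) by simp
    qed
  qed simp
qed

lemma almost_limited_subset:
  assumes B: "almost_limited B" and AB: "A \<subseteq> B"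
  shows "almost_limited A"
  unfolding almost_limited_def
proof (intro conjI allI impI)
  show "bounded A" using assms bounded_subset by (auto simp: almost_limited_def)
  fix f :: "nat \<Rightarrow> 'a \<Rightarrow>\<^sub>L real"
  assume "dual_disjoint_seq f \<and> weak_star_null f"
  then have "(\<lambda>n. SUP y\<in>B. ennreal \<bar>blinfun_apply (f n) y\<bar>) \<longlonglongrightarrow> 0"
    using B by (simp add: almost_limited_def)
  then show "(\<lambda>n. SUP y\<in>A. ennreal \<bar>blinfun_apply (f n) y\<bar>) \<longlonglongrightarrow> 0"
    by (rule tendsto_sandwich[OF _ _ tendsto_const, rotated 2]) (intro always_eventually allI SUP_subset_mono AB zero_le order_refl)+
qed


section \<open>The equivalence of the conditions\<close>

lemma weak_almost_limited_tendsto: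
  assumes T: "weak_almost_limited T" and x: "weakly_null x"
    and f: "dual_disjoint_seq f" "weak_star_null f"
  shows "(\<lambda>n. blinfun_apply (f n) (blinfun_apply T (x n))) \<longlonglongrightarrow> 0"
proof -
  have "almost_limited (blinfun_apply T ` range x)"
    using T weakly_null_imp_relatively_weakly_compact[OF x] by (simp add: weak_almost_limited_def)
  then show ?thesis using f by (rule almost_limited_tendsto) simp
qed

lemma subset_solid_hull: "A \<subseteq> solid_hull A"
  by (auto simp: solid_hull_def)

lemma bounded_solid_hull:
  assumes "bounded A"
  shows "bounded (solid_hull A)"
proof -
  obtain M where "\<And>x. x \<in> A \<Longrightarrow> norm x \<le> M" using assms by (auto simp: bounded_iff)
  then have "norm y \<le> M" if "y \<in> solid_hull A" for y
    using that norm_le_if_abs_le unfolding solid_hull_def by (blast intro: order_trans)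
  then show ?thesis by (auto simp: bounded_iff)
qed

theorem theorem2p4:
  fixes T :: "'e::banach_lattice \<Rightarrow>\<^sub>L 'f::banach_lattice"
  assumes "seq_weak_star_continuous_lattice_ops TYPE('e) \<or> property_d TYPE('f)"
    and "order_bounded_operator T"
  defines "A1 \<equiv> weak_almost_limited T"
    and "A2 \<equiv> \<forall>x f. weakly_null x \<and> (\<forall>n. 0 \<le> x n) \<and> dual_disjoint_seq f \<and> weak_star_null f
                \<longrightarrow> (\<lambda>n. blinfun_apply (f n) (blinfun_apply T (x n))) \<longlonglongrightarrow> 0"
    and "A3 \<equiv> \<forall>x f. disjoint_seq x \<and> weakly_null x \<and> dual_disjoint_seq f \<and> weak_star_null f
                \<longrightarrow> (\<lambda>n. blinfun_apply (f n) (blinfun_apply T (x n))) \<longlonglongrightarrow> 0"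
    and "A4 \<equiv> \<forall>x f. disjoint_seq x \<and> weakly_null x \<and> (\<forall>n. 0 \<le> x n)
                  \<and> dual_disjoint_seq f \<and> weak_star_null f
                \<longrightarrow> (\<lambda>n. blinfun_apply (f n) (blinfun_apply T (x n))) \<longlonglongrightarrow> 0"
    and "A5 \<equiv> \<forall>A. relatively_weakly_compact A \<longrightarrow> almost_limited (blinfun_apply T ` solid_hull A)"
    and "A6 \<equiv> \<forall>x f. weakly_null x \<and> (\<forall>n. 0 \<le> x n)
                  \<and> dual_disjoint_seq f \<and> weak_star_null f \<and> (\<forall>n. dual_le 0 (f n))
                \<longrightarrow> (\<lambda>n. blinfun_apply (f n) (blinfun_apply T (x n))) \<longlonglongrightarrow> 0"
    and "A7 \<equiv> \<forall>x f. disjoint_seq x \<and> weakly_null x \<and> (\<forall>n. 0 \<le> x n)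
                  \<and> dual_disjoint_seq f \<and> weak_star_null f \<and> (\<forall>n. dual_le 0 (f n))
                \<longrightarrow> (\<lambda>n. blinfun_apply (f n) (blinfun_apply T (x n))) \<longlonglongrightarrow> 0"
  shows "(A1 \<longleftrightarrow> A2) \<and> (A1 \<longleftrightarrow> A3) \<and> (A1 \<longleftrightarrow> A4) \<and> (A1 \<longleftrightarrow> A5)
    \<and> (property_d TYPE('f) \<longrightarrow> (A1 \<longleftrightarrow> A6) \<and> (A1 \<longleftrightarrow> A7))"
proof -
  have imp_12: "A2" if A1
    unfolding A2_def
  proof (intro allI impI)
    fix x :: "nat \<Rightarrow> 'e" and f :: "nat \<Rightarrow> 'f \<Rightarrow>\<^sub>L real"
    assume "weakly_null x \<and> (\<forall>n. 0 \<le> x n) \<and> dual_disjoint_seq f \<and> weak_star_null f"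
    then show "(\<lambda>n. blinfun_apply (f n) (blinfun_apply T (x n))) \<longlonglongrightarrow> 0"
      using that weak_almost_limited_tendsto unfolding A1_def by blast
  qed
  have imp_13: "A3" if A1
    unfolding A3_def
  proof (intro allI impI)
    fix x :: "nat \<Rightarrow> 'e" and f :: "nat \<Rightarrow> 'f \<Rightarrow>\<^sub>L real"
    assume "disjoint_seq x \<and> weakly_null x \<and> dual_disjoint_seq f \<and> weak_star_null f"
    then show "(\<lambda>n. blinfun_apply (f n) (blinfun_apply T (x n))) \<longlonglongrightarrow> 0"
      using that weak_almost_limited_tendsto unfolding A1_def by blast
  qed
  have imp_24: "A2 \<Longrightarrow> A4" and imp_34: "A3 \<Longrightarrow> A4" and imp_26: "A2 \<Longrightarrow> A6" and imp_67: "A6 \<Longrightarrow> A7"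
    unfolding A2_def A3_def A4_def A6_def A7_def by blast+
  have imp_51: "A1" if A5
    unfolding A1_def weak_almost_limited_def
  proof (intro allI impI)
    fix A :: "'e set" assume "relatively_weakly_compact A"
    then have "almost_limited (blinfun_apply T ` solid_hull A)" using that by (simp add: A5_def)
    then show "almost_limited (blinfun_apply T ` A)"
      by (rule almost_limited_subset) (intro image_mono subset_solid_hull)
  qed
  have imp_45: "A5" if A4
    unfolding A5_def
  proof (intro allI impI almost_limitedI)
    fix A :: "'e set" assume A: "relatively_weakly_compact A"
    then have B: "bounded (solid_hull A)"
      by (intro bounded_solid_hull relatively_weakly_compact_imp_bounded)
    then show "bounded (blinfun_apply T ` solid_hull A)"
      by (rule bounded_linear_image) (rule blinfun.bounded_linear_right)
    fix f :: "nat \<Rightarrow> 'f \<Rightarrow>\<^sub>L real" and \<epsilon> :: real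
    assume f: "dual_disjoint_seq f" "weak_star_null f" and \<epsilon>: "0 < \<epsilon>"
    have null: "weak_star_null (\<lambda>n. dual_abs (f n o\<^sub>L T))"
      using assms(1)
    proof
      assume E: "seq_weak_star_continuous_lattice_ops TYPE('e)"
      have "weak_star_null (\<lambda>n. f n o\<^sub>L T)" using f(2) by (simp add: weak_star_null_iff)
      then show ?thesis using E by (simp add: seq_weak_star_continuous_lattice_ops_def)
    next
      assume "property_d TYPE('f)"
      then have "weak_star_null (\<lambda>n. dual_abs (f n))" using f by (simp add: property_d_def)
      then show ?thesis by (rule weak_star_null_abs_compose[OF assms(2)])
    qed
    have "\<forall>\<^sub>F n in sequentially. \<forall>x\<in>solid_hull A. \<bar>blinfun_apply (f n o\<^sub>L T) x\<bar> \<le> \<epsilon>"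
    proof (rule solid_disjoint_uniform[OF B _ null _ \<epsilon>])
      show "y \<in> solid_hull A" if "x \<in> solid_hull A" "\<bar>y\<bar> \<le> \<bar>x\<bar>" for x y
        using that unfolding solid_hull_def by (blast intro: order_trans)
      \<comment> \<open>The subsequence \<open>f (r n)\<close> is again disjoint and weak* null, so
        (4) can be applied to it together with \<open>u\<close>.\<close>
      fix r :: "nat \<Rightarrow> nat" and u :: "nat \<Rightarrow> 'e"
      assume r: "strict_mono r" and u: "disjoint_seq u" "\<And>n. 0 \<le> u n" "\<And>n. u n \<in> solid_hull A"
      have "weakly_null u" using disjoint_solid_hull_weakly_null[OF A u] .
      moreover have "dual_disjoint_seq (\<lambda>n. f (r n))" "weak_star_null (\<lambda>n. f (r n))"
        using dual_disjoint_seq_subseq[OF f(1) r] weak_star_null_subseq[OF f(2) r] .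
      ultimately show "(\<lambda>n. blinfun_apply (f (r n) o\<^sub>L T) (u n)) \<longlonglongrightarrow> 0"
        using \<open>A4\<close>[unfolded A4_def, rule_format, of u "\<lambda>n. f (r n)"] u by simp
    qed
    then show "\<forall>\<^sub>F n in sequentially. \<forall>y\<in>blinfun_apply T ` solid_hull A. \<bar>blinfun_apply (f n) y\<bar> \<le> \<epsilon>"
      by simp
  qed
  have imp_74: "A4" if d: "property_d TYPE('f)" and A7
    unfolding A4_def
  proof (intro allI impI, elim conjE)
    fix x :: "nat \<Rightarrow> 'e" and f :: "nat \<Rightarrow> 'f \<Rightarrow>\<^sub>L real"
    assume x: "disjoint_seq x" "weakly_null x" "\<forall>n. 0 \<le> x n" and f: "dual_disjoint_seq f" "weak_star_null f"
    have abs_null: "weak_star_null (\<lambda>n. dual_abs (f n))" using d f by (simp add: property_d_def)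
    \<comment> \<open>To be used for the positive and the negative parts of \<open>f n\<close>: both
      are dominated by the modulus, from which they inherit disjointness and, through property (d),
      weak* nullity.\<close>
    have part: "(\<lambda>n. blinfun_apply (g n) (blinfun_apply T (x n))) \<longlonglongrightarrow> 0"
      if g: "\<And>n. dual_le 0 (g n)" "\<And>n. dual_le (g n) (dual_abs (f n))" for g
    proof -
      have "dual_disjoint_seq g" using f(1) g by (rule dual_disjoint_seq_dominated)
      moreover have "weak_star_null g"
        by (rule weak_star_null_dominated[OF abs_null]) (simp add: dual_abs_of_nonneg g)
      ultimately show ?thesis using \<open>A7\<close> x g(1) unfolding A7_def by blast
    qed
    have "(\<lambda>n. blinfun_apply (dual_sup (f n) 0) (blinfun_apply T (x n))
        - blinfun_apply (dual_sup (- f n) 0) (blinfun_apply T (x n))) \<longlonglongrightarrow> 0 - 0"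
      by (intro tendsto_diff part dual_sup_lub dual_le_abs dual_abs_nonneg)
    then show "(\<lambda>n. blinfun_apply (f n) (blinfun_apply T (x n))) \<longlonglongrightarrow> 0"
      unfolding blinfun.diff_left[symmetric] dual_pos_neg_part[symmetric] by simp
  qed
  \<comment> \<open>The implications (1) to (2) to (4), (1) to (3) to (4) and (4) to (5) to (1)
    close the first circle; (2) to (6) to (7) and, under property (d), (7) to (4) attach the
    rest.\<close>
  show ?thesis
    using imp_12 imp_13 imp_24 imp_34 imp_45 imp_51 imp_26 imp_67 imp_74 by argo
qed

end
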